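(* Let $\mathfrak h=\mathfrak h_{-l}\oplus\cdots\oplus\mathfrak h_l$ be a semisimple Lie algebra with an $|l|$-gradation, $B$ its Killing form, and $\theta:\mathfrak h\to\mathfrak h$ a Cartan involution with $\theta(\mathfrak h_i)=\mathfrak h_{-i}$ for any $i$. Then the metric $\langle\cdot,\cdot\rangle=B_\theta$ on $\mathfrak h$, defined by $$B_\theta(X,Y):=-B(X,\theta(Y)),\quad\forall X,Y\in\mathfrak h,$$ is admissible.
   Context: Lie algebras are real and finite dimensional. The gradation satisfies $[\mathfrak{h}_i,\mathfrak{h}_j]\subset\mathfrak{h}_{i+j}$ and is fundamental: $\mathfrak{h}_-:=\oplus_{i<0}\mathfrak{h}_i$ is generated by $\mathfrak{h}_{-1}$; $\mathfrak{h}_0,\mathfrak{h}_{\pm l}$ are non-trivial; the adjoint action of $\mathfrak{h}_0$ on $\mathfrak{h}_{-1}$ is exact (faithful). $\mathfrak{h}_+=\oplus_{i>0}\mathfrak{h}_i$, $\mathfrak q=\mathfrak h_0\oplus\mathfrak h_+$. $H$ is a connected Lie group with Lie algebra $\mathfrak h$ and $Q$ its connected subgroup with Lie algebra $\mathfrak q$. The metric $B_\theta$ is positive definite and adapted to the gradation ($B_\theta(\mathfrak h_i,\mathfrak h_j)=0$ for $i\neq j$). $C^k(\mathfrak h_-,\mathfrak h)=\Lambda^k(\mathfrak h_-^* )\otimes\mathfrak h$, with Lie algebra differential $$(\partial\phi)(X_0,\dots,X_k)=\sum_i(-1)^i[X_i,\phi(\dots,\widehat{X_i},\dots)]+\sum_{i<j}(-1)^{i+j}\phi([X_i,X_j],\dots,\widehat{X_i},\dots,\widehat{X_j},\dots),$$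 and $\partial^*:C^{k+1}(\mathfrak h_-,\mathfrak h)\to C^k(\mathfrak h_-,\mathfrak h)$ is its metric adjoint with respect to the metrics naturally induced on the spaces $C^k(\mathfrak h_-,\mathfrak h)$. $Q$ acts on $\mathfrak h_-\cong\mathfrak h/\mathfrak q$ by the action $\mathrm{Ad}^-$ induced by the adjoint action, and on $C^k(\mathfrak h_-,\mathfrak h)$ by $(g\cdot\phi)(X_1,\dots,X_k)=\mathrm{Ad}_g(\phi(\mathrm{Ad}^-_{g^{-1}}X_1,\dots,\mathrm{Ad}^-_{g^{-1}}X_k))$. A Euclidean metric on $\mathfrak h$, adapted to the gradation, is admissible if $\partial^*:C^{k+1}(\mathfrak h_-,\mathfrak h)\to C^k(\mathfrak h_-,\mathfrak h)$ is $Q$-invariant (commutes with the $Q$-actions) for every $k\ge0$. *)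

theory Defs
  imports "HOL-Analysis.Analysis" "HOL-Algebra.Group"
begin

text \<open>
  A finite-dimensional real Lie algebra is given by a bracket on a type of class
  \<^class>\<open>euclidean_space\<close>. The inner product of that class only supplies the topology of the
  underlying vector space and a basis for computing traces; it is unrelated to the metrics studied
  here.
\<close>

definition lie_algebra :: "('h::real_vector \<Rightarrow> 'h \<Rightarrow> 'h) \<Rightarrow> bool" where
  "lie_algebra br \<longleftrightarrow>
     (\<forall>x. linear (br x)) \<and> (\<forall>y. linear (\<lambda>x. br x y)) \<and>
     (\<forall>x. br x x = 0) \<and>
     (\<forall>x y z. br x (br y z) + br y (br z x) + br z (br x y) = 0)"

definition lie_subalgebra :: "('h::real_vector \<Rightarrow> 'h \<Rightarrow> 'h) \<Rightarrow> 'h set \<Rightarrow> bool" where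
  "lie_subalgebra br A \<longleftrightarrow> subspace A \<and> (\<forall>x\<in>A. \<forall>y\<in>A. br x y \<in> A)"

definition lie_generated :: "('h::real_vector \<Rightarrow> 'h \<Rightarrow> 'h) \<Rightarrow> 'h set \<Rightarrow> 'h set" where
  "lie_generated br S = \<Inter> {A. lie_subalgebra br A \<and> S \<subseteq> A}"

definition lie_ideal :: "('h::real_vector \<Rightarrow> 'h \<Rightarrow> 'h) \<Rightarrow> 'h set \<Rightarrow> bool" where
  "lie_ideal br A \<longleftrightarrow> subspace A \<and> (\<forall>x. \<forall>y\<in>A. br x y \<in> A)"

definition derived_algebra :: "('h::real_vector \<Rightarrow> 'h \<Rightarrow> 'h) \<Rightarrow> 'h set \<Rightarrow> 'h set" where
  "derived_algebra br A = span {br x y |x y. x \<in> A \<and> y \<in> A}"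

definition lie_solvable :: "('h::real_vector \<Rightarrow> 'h \<Rightarrow> 'h) \<Rightarrow> 'h set \<Rightarrow> bool" where
  "lie_solvable br A \<longleftrightarrow> (\<exists>n. (derived_algebra br ^^ n) A = {0})"

definition semisimple :: "('h::real_vector \<Rightarrow> 'h \<Rightarrow> 'h) \<Rightarrow> bool" where
  "semisimple br \<longleftrightarrow> lie_algebra br \<and>
     (\<forall>A. lie_ideal br A \<and> lie_solvable br A \<longrightarrow> A = {0})"

definition lin_trace :: "('h::euclidean_space \<Rightarrow> 'h) \<Rightarrow> real" where
  "lin_trace f = (\<Sum>b\<in>Basis. f b \<bullet> b)"

definition killing :: "('h::euclidean_space \<Rightarrow> 'h \<Rightarrow> 'h) \<Rightarrow> 'h \<Rightarrow> 'h \<Rightarrow> real" where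
  "killing br X Y = lin_trace (br X \<circ> br Y)"

definition euclidean_metric :: "('h::real_vector \<Rightarrow> 'h \<Rightarrow> real) \<Rightarrow> bool" where
  "euclidean_metric g \<longleftrightarrow>
     (\<forall>x. linear (g x)) \<and> (\<forall>y. linear (\<lambda>x. g x y)) \<and>
     (\<forall>x y. g x y = g y x) \<and> (\<forall>x. x \<noteq> 0 \<longrightarrow> g x x > 0)"

definition killing_metric ::
    "('h::euclidean_space \<Rightarrow> 'h \<Rightarrow> 'h) \<Rightarrow> ('h \<Rightarrow> 'h) \<Rightarrow> 'h \<Rightarrow> 'h \<Rightarrow> real" where
  "killing_metric br \<theta> X Y = - killing br X (\<theta> Y)"

definition cartan_involution ::
    "('h::euclidean_space \<Rightarrow> 'h \<Rightarrow> 'h) \<Rightarrow> ('h \<Rightarrow> 'h) \<Rightarrow> bool" where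
  "cartan_involution br \<theta> \<longleftrightarrow>
     linear \<theta> \<and> (\<forall>x y. \<theta> (br x y) = br (\<theta> x) (\<theta> y)) \<and> (\<forall>x. \<theta> (\<theta> x) = x) \<and>
     (\<forall>x. x \<noteq> 0 \<longrightarrow> killing_metric br \<theta> x x > 0)"

definition neg_part :: "(int \<Rightarrow> 'h::real_vector set) \<Rightarrow> 'h set" where
  "neg_part hh = span (\<Union>i\<in>{..<0}. hh i)"

definition nonneg_part :: "(int \<Rightarrow> 'h::real_vector set) \<Rightarrow> 'h set" where
  "nonneg_part hh = span (\<Union>i\<in>{0..}. hh i)"

text \<open>The components are indexed by all integers; those of degree outside \<open>-l..l\<close> are zero.\<close>

definition graded_by ::
    "('h::real_vector \<Rightarrow> 'h \<Rightarrow> 'h) \<Rightarrow> nat \<Rightarrow> (int \<Rightarrow> 'h set) \<Rightarrow> bool" where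
  "graded_by br l hh \<longleftrightarrow>
     (\<forall>i. subspace (hh i)) \<and> (\<forall>i. \<bar>i\<bar> > int l \<longrightarrow> hh i = {0}) \<and>
     (\<forall>x. \<exists>!f. (\<forall>i. f i \<in> hh i) \<and> x = (\<Sum>i\<in>{- int l..int l}. f i)) \<and>
     (\<forall>i j. \<forall>x\<in>hh i. \<forall>y\<in>hh j. br x y \<in> hh (i + j))"

definition fundamental_gradation ::
    "('h::real_vector \<Rightarrow> 'h \<Rightarrow> 'h) \<Rightarrow> nat \<Rightarrow> (int \<Rightarrow> 'h set) \<Rightarrow> bool" where
  "fundamental_gradation br l hh \<longleftrightarrow>
     graded_by br l hh \<and>
     lie_generated br (hh (-1)) = neg_part hh \<and>
     hh 0 \<noteq> {0} \<and> hh (int l) \<noteq> {0} \<and> hh (- int l) \<noteq> {0} \<and>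
     (\<forall>x\<in>hh 0. (\<forall>y\<in>hh (-1). br x y = 0) \<longrightarrow> x = 0)"

definition adapted_metric ::
    "(int \<Rightarrow> 'h::real_vector set) \<Rightarrow> ('h \<Rightarrow> 'h \<Rightarrow> real) \<Rightarrow> bool" where
  "adapted_metric hh g \<longleftrightarrow> (\<forall>i j. i \<noteq> j \<longrightarrow> (\<forall>x\<in>hh i. \<forall>y\<in>hh j. g x y = 0))"

text \<open>
  A \<open>k\<close>-cochain on a subspace \<open>V\<close> is an alternating \<open>k\<close>-linear map on \<open>V\<close>, encoded as a function on
  lists of length \<open>k\<close> over \<open>V\<close> and set to zero on all other lists, so that equality of cochains is
  equality of functions.
\<close>

definition cochains :: "'h::real_vector set \<Rightarrow> nat \<Rightarrow> ('h list \<Rightarrow> 'h) set" where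
  "cochains V k = {\<phi>.
     (\<forall>xs. \<not> (length xs = k \<and> set xs \<subseteq> V) \<longrightarrow> \<phi> xs = 0) \<and>
     (\<forall>xs i x y a b. length xs = k \<and> set xs \<subseteq> V \<and> i < k \<and> x \<in> V \<and> y \<in> V \<longrightarrow>
        \<phi> (xs[i := a *\<^sub>R x + b *\<^sub>R y]) = a *\<^sub>R \<phi> (xs[i := x]) + b *\<^sub>R \<phi> (xs[i := y])) \<and>
     (\<forall>xs i j. length xs = k \<and> set xs \<subseteq> V \<and> i < j \<and> j < k \<and> xs ! i = xs ! j \<longrightarrow> \<phi> xs = 0)}"

text \<open>\<open>nths xs (- I)\<close> is the list \<open>xs\<close> with the entries at the positions in \<open>I\<close> omitted.\<close>

definition coboundary ::
    "('h::real_vector \<Rightarrow> 'h \<Rightarrow> 'h) \<Rightarrow> 'h set \<Rightarrow> nat \<Rightarrow> ('h list \<Rightarrow> 'h) \<Rightarrow> 'h list \<Rightarrow> 'h" where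
  "coboundary br V k \<phi> xs =
     (if length xs = Suc k \<and> set xs \<subseteq> V
      then (\<Sum>i\<le>k. (-1) ^ i *\<^sub>R br (xs ! i) (\<phi> (nths xs (- {i})))) +
           (\<Sum>j\<le>k. \<Sum>i<j. (-1) ^ (i + j) *\<^sub>R \<phi> (br (xs ! i) (xs ! j) # nths xs (- {i, j})))
      else 0)"

definition orthonormal_basis ::
    "('h::real_vector \<Rightarrow> 'h \<Rightarrow> real) \<Rightarrow> 'h set \<Rightarrow> 'h set \<Rightarrow> bool" where
  "orthonormal_basis g V E \<longleftrightarrow>
     finite E \<and> E \<subseteq> V \<and> span E = V \<and> (\<forall>x\<in>E. \<forall>y\<in>E. g x y = (if x = y then 1 else 0))"

text \<open>
  The metric induced on \<open>k\<close>-cochains. Summing over all \<open>k\<close>-tuples of basis vectors counts every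
  strictly increasing tuple \<open>k!\<close> times. The value does not depend on the orthonormal basis chosen.
\<close>

definition cochain_metric ::
    "('h::real_vector \<Rightarrow> 'h \<Rightarrow> real) \<Rightarrow> 'h set \<Rightarrow> nat \<Rightarrow> ('h list \<Rightarrow> 'h) \<Rightarrow> ('h list \<Rightarrow> 'h) \<Rightarrow> real"
  where
  "cochain_metric g V k \<phi> \<psi> =
     (let E = (SOME E. orthonormal_basis g V E)
      in (\<Sum>xs | length xs = k \<and> set xs \<subseteq> E. g (\<phi> xs) (\<psi> xs)) / fact k)"

text \<open>The metric adjoint, from \<open>(k+1)\<close>-cochains to \<open>k\<close>-cochains.\<close>

definition codifferential ::
    "('h::real_vector \<Rightarrow> 'h \<Rightarrow> 'h) \<Rightarrow> ('h \<Rightarrow> 'h \<Rightarrow> real) \<Rightarrow> 'h set \<Rightarrow> nat \<Rightarrow>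
      ('h list \<Rightarrow> 'h) \<Rightarrow> 'h list \<Rightarrow> 'h" where
  "codifferential br g V k \<phi> =
     (THE \<psi>. \<psi> \<in> cochains V k \<and>
        (\<forall>\<eta>\<in>cochains V k.
           cochain_metric g V (Suc k) (coboundary br V k \<eta>) \<phi> = cochain_metric g V k \<eta> \<psi>))"

text \<open>
  Intended for open sets \<open>S\<close> in finite dimension, where continuity of all iterated directional
  derivatives of order up to \<open>k\<close> is the same as being \<open>k\<close> times continuously differentiable.
\<close>

primrec Ck_on ::
    "nat \<Rightarrow> 'a::real_normed_vector set \<Rightarrow> ('a \<Rightarrow> 'b::real_normed_vector) \<Rightarrow> bool" where
  "Ck_on 0 S f \<longleftrightarrow> continuous_on S f"
| "Ck_on (Suc k) S f \<longleftrightarrow>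
     (\<forall>x\<in>S. f differentiable (at x)) \<and> (\<forall>v. Ck_on k S (\<lambda>x. frechet_derivative f (at x) v))"

definition smooth_on ::
    "'a::real_normed_vector set \<Rightarrow> ('a \<Rightarrow> 'b::real_normed_vector) \<Rightarrow> bool" where
  "smooth_on S f \<longleftrightarrow> (\<forall>k. Ck_on k S f)"

type_synonym ('g, 'm) chart = "'g set \<times> ('g \<Rightarrow> 'm)"

definition is_chart :: "'g topology \<Rightarrow> ('g, 'm::euclidean_space) chart \<Rightarrow> bool" where
  "is_chart T = (\<lambda>(U, \<phi>). openin T U \<and> open (\<phi> ` U) \<and>
     homeomorphic_map (subtopology T U) (top_of_set (\<phi> ` U)) \<phi>)"

definition smooth_manifold :: "'g topology \<Rightarrow> ('g, 'm::euclidean_space) chart set \<Rightarrow> bool" where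
  "smooth_manifold T A \<longleftrightarrow>
     Hausdorff_space T \<and> second_countable T \<and>
     (\<forall>c\<in>A. is_chart T c) \<and> (\<Union>(U, \<phi>)\<in>A. U) = topspace T \<and>
     (\<forall>(U, \<phi>)\<in>A. \<forall>(V, \<psi>)\<in>A. smooth_on (\<phi> ` (U \<inter> V)) (\<psi> \<circ> inv_into U \<phi>))"

definition smooth_map ::
    "'g topology \<Rightarrow> ('g, 'm::euclidean_space) chart set \<Rightarrow>
     'k topology \<Rightarrow> ('k, 'n::euclidean_space) chart set \<Rightarrow> ('g \<Rightarrow> 'k) \<Rightarrow> bool" where
  "smooth_map T A T' A' f \<longleftrightarrow> continuous_map T T' f \<and>
     (\<forall>(U, \<phi>)\<in>A. \<forall>(V, \<psi>)\<in>A'. smooth_on (\<phi> ` {p \<in> U. f p \<in> V}) (\<psi> \<circ> f \<circ> inv_into U \<phi>))"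

definition prod_atlas ::
    "('g, 'm) chart set \<Rightarrow> ('k, 'n) chart set \<Rightarrow> ('g \<times> 'k, 'm \<times> 'n) chart set" where
  "prod_atlas A A' = {(U \<times> V, map_prod \<phi> \<psi>) |U \<phi> V \<psi>. (U, \<phi>) \<in> A \<and> (V, \<psi>) \<in> A'}"

record ('g, 'm) smooth_group = "'g monoid" +
  topol :: "'g topology"
  atlas :: "('g, 'm) chart set"

definition lie_group :: "('g, 'm::euclidean_space) smooth_group \<Rightarrow> bool" where
  "lie_group G \<longleftrightarrow>
     group G \<and> topspace (topol G) = carrier G \<and> smooth_manifold (topol G) (atlas G) \<and>
     smooth_map (prod_topology (topol G) (topol G)) (prod_atlas (atlas G) (atlas G))
       (topol G) (atlas G) (\<lambda>(x, y). x \<otimes>\<^bsub>G\<^esub> y) \<and>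
     smooth_map (topol G) (atlas G) (topol G) (atlas G) (\<lambda>x. inv\<^bsub>G\<^esub> x)"

text \<open>
  A chart \<open>(U, \<kappa>)\<close> around the identity element identifies the tangent space there with the model
  space \<open>'m\<close>. In this identification \<open>Ad_in_chart G U \<kappa> g\<close> is the differential at the identity of
  conjugation by \<open>g\<close>, and the bracket on the tangent space is given by the differential of
  \<open>Ad\<close> at the identity.
\<close>

definition Ad_in_chart ::
    "('g, 'm::euclidean_space) smooth_group \<Rightarrow> 'g set \<Rightarrow> ('g \<Rightarrow> 'm) \<Rightarrow> 'g \<Rightarrow> 'm \<Rightarrow> 'm" where
  "Ad_in_chart G U \<kappa> g =
     frechet_derivative (\<lambda>x. \<kappa> (g \<otimes>\<^bsub>G\<^esub> inv_into U \<kappa> x \<otimes>\<^bsub>G\<^esub> inv\<^bsub>G\<^esub> g)) (at (\<kappa> \<one>\<^bsub>G\<^esub>))"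

definition bracket_in_chart ::
    "('g, 'm::euclidean_space) smooth_group \<Rightarrow> 'g set \<Rightarrow> ('g \<Rightarrow> 'm) \<Rightarrow> 'm \<Rightarrow> 'm \<Rightarrow> 'm" where
  "bracket_in_chart G U \<kappa> X Y =
     frechet_derivative (\<lambda>x. Ad_in_chart G U \<kappa> (inv_into U \<kappa> x) Y) (at (\<kappa> \<one>\<^bsub>G\<^esub>)) X"

text \<open>
  \<open>G\<close> is a connected Lie group with Lie algebra \<open>(UNIV, br)\<close>: the map \<open>\<iota>\<close> is an isomorphism of Lie
  algebras onto the tangent space at the identity, the latter identified with \<open>'m\<close> by \<open>\<kappa>\<close>.
\<close>

definition connected_lie_group_of ::
    "('h::euclidean_space \<Rightarrow> 'h \<Rightarrow> 'h) \<Rightarrow> ('g, 'm::euclidean_space) smooth_group \<Rightarrow>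
     'g set \<Rightarrow> ('g \<Rightarrow> 'm) \<Rightarrow> ('h \<Rightarrow> 'm) \<Rightarrow> bool" where
  "connected_lie_group_of br G U \<kappa> \<iota> \<longleftrightarrow>
     lie_group G \<and> connected_space (topol G) \<and>
     (U, \<kappa>) \<in> atlas G \<and> \<one>\<^bsub>G\<^esub> \<in> U \<and>
     linear \<iota> \<and> bij \<iota> \<and> (\<forall>X Y. \<iota> (br X Y) = bracket_in_chart G U \<kappa> (\<iota> X) (\<iota> Y))"

definition Ad ::
    "('g, 'm::euclidean_space) smooth_group \<Rightarrow> 'g set \<Rightarrow> ('g \<Rightarrow> 'm) \<Rightarrow>
     ('h::euclidean_space \<Rightarrow> 'm) \<Rightarrow> 'g \<Rightarrow> 'h \<Rightarrow> 'h" where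
  "Ad G U \<kappa> \<iota> g X = inv_into UNIV \<iota> (Ad_in_chart G U \<kappa> g (\<iota> X))"

text \<open>
  A Lie subgroup is an injectively immersed one: its topology may be finer than the subspace
  topology, and its underlying set need not be closed.
\<close>

definition lie_subgroup ::
    "('g, 'q::euclidean_space) smooth_group \<Rightarrow> ('g, 'm::euclidean_space) smooth_group \<Rightarrow> bool" where
  "lie_subgroup Q G \<longleftrightarrow>
     lie_group Q \<and> lie_group G \<and> (\<lambda>x. x) \<in> hom Q G \<and>
     smooth_map (topol Q) (atlas Q) (topol G) (atlas G) (\<lambda>x. x) \<and>
     (\<forall>(V, \<psi>)\<in>atlas Q. \<forall>(W, \<phi>)\<in>atlas G. \<forall>p\<in>V \<inter> W.
        inj (frechet_derivative (\<phi> \<circ> inv_into V \<psi>) (at (\<psi> p))))"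

text \<open>
  The last clause says that the tangent space at the identity of \<open>Q\<close>, as a subspace of that of
  \<open>G\<close>, corresponds to \<open>\<qq>\<close> under \<open>\<iota>\<close>.
\<close>

definition connected_lie_subgroup_of ::
    "('g, 'q::euclidean_space) smooth_group \<Rightarrow> ('g, 'm::euclidean_space) smooth_group \<Rightarrow>
     'g set \<Rightarrow> ('g \<Rightarrow> 'm) \<Rightarrow> ('h::euclidean_space \<Rightarrow> 'm) \<Rightarrow> 'h set \<Rightarrow> bool" where
  "connected_lie_subgroup_of Q G U \<kappa> \<iota> \<qq> \<longleftrightarrow>
     lie_subgroup Q G \<and> connected_space (topol Q) \<and>
     (\<forall>(V, \<psi>)\<in>atlas Q. \<one>\<^bsub>Q\<^esub> \<in> V \<longrightarrow>
        range (frechet_derivative (\<kappa> \<circ> inv_into V \<psi>) (at (\<psi> \<one>\<^bsub>Q\<^esub>))) = \<iota> ` \<qq>)"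

text \<open>
  \<open>A\<close> is a linear map preserving the nonnegative part. The result is the map induced on the
  quotient by the nonnegative part, transported to the negative part.
\<close>

definition induced_on_neg :: "(int \<Rightarrow> 'h::real_vector set) \<Rightarrow> ('h \<Rightarrow> 'h) \<Rightarrow> 'h \<Rightarrow> 'h" where
  "induced_on_neg hh A X = (THE Y. Y \<in> neg_part hh \<and> A X - Y \<in> nonneg_part hh)"

definition cochain_action ::
    "('g, 'm::euclidean_space) smooth_group \<Rightarrow> 'g set \<Rightarrow> ('g \<Rightarrow> 'm) \<Rightarrow>
     ('h::euclidean_space \<Rightarrow> 'm) \<Rightarrow> (int \<Rightarrow> 'h set) \<Rightarrow> 'g \<Rightarrow> ('h list \<Rightarrow> 'h) \<Rightarrow> 'h list \<Rightarrow> 'h" where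
  "cochain_action G U \<kappa> \<iota> hh g \<phi> xs =
     (if set xs \<subseteq> neg_part hh
      then Ad G U \<kappa> \<iota> g (\<phi> (map (induced_on_neg hh (Ad G U \<kappa> \<iota> (inv\<^bsub>G\<^esub> g))) xs))
      else 0)"

definition admissible ::
    "('h::euclidean_space \<Rightarrow> 'h \<Rightarrow> 'h) \<Rightarrow> (int \<Rightarrow> 'h set) \<Rightarrow>
     ('g, 'm::euclidean_space) smooth_group \<Rightarrow> 'g set \<Rightarrow> ('g \<Rightarrow> 'm) \<Rightarrow> ('h \<Rightarrow> 'm) \<Rightarrow>
     ('g, 'q::euclidean_space) smooth_group \<Rightarrow> ('h \<Rightarrow> 'h \<Rightarrow> real) \<Rightarrow> bool" where
  "admissible br hh G U \<kappa> \<iota> Q g \<longleftrightarrow>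
     euclidean_metric g \<and> adapted_metric hh g \<and>
     (\<forall>k. \<forall>\<phi>\<in>cochains (neg_part hh) (Suc k). \<forall>a\<in>carrier Q.
        codifferential br g (neg_part hh) k (cochain_action G U \<kappa> \<iota> hh a \<phi>) =
        cochain_action G U \<kappa> \<iota> hh a (codifferential br g (neg_part hh) k \<phi>))"

end

theory Submission
  imports Defs
begin

text \<open>
  The codifferential is the metric adjoint of the coboundary, so it commutes with the action of
  \<open>a \<in> Q\<close> as soon as the metric adjoint of that action commutes with the coboundary. This is what
  makes the metric \<open>B\<^sub>\<theta>\<close> special.

  Write \<open>A = Ad a\<close>. Since \<open>A\<close> is an automorphism of the Lie algebra, it preserves the Killing form,
  and its adjoint with respect to \<open>B\<^sub>\<theta>\<close> is \<open>\<theta> \<circ> A\<inverse> \<circ> \<theta>\<close>, again an automorphism. The action of \<open>a\<close>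
  on a cochain \<open>\<phi>\<close> is \<open>A \<circ> \<phi> \<circ> D\<close>, where \<open>D\<close> is the compression of \<open>A\<inverse>\<close> to the negative part. The
  adjoint of this operation is \<open>\<psi> \<mapsto> C' \<circ> \<psi> \<circ> D'\<close> with \<open>C' = \<theta> \<circ> A\<inverse> \<circ> \<theta>\<close> and \<open>D' = \<theta> \<circ> A \<circ> \<theta>\<close>: the
  compression can be dropped, because \<open>A\<inverse>\<close> preserves the nonnegative part, so its adjoint \<open>D'\<close>
  preserves the orthogonal complement of the nonnegative part, which is the negative part. Thus the
  adjoint action is conjugation by an automorphism that preserves the negative part, and it commutes
  with the coboundary by naturality (\<open>coboundary_transport\<close>, \<open>cochain_metric_transport\<close>,
  \<open>codifferential_transport\<close>, \<open>codifferential_automorphism\<close>).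

  The argument uses that the metric adjoint exists, which is the Riesz representation theorem for
  the finite dimensional space of cochains (\<open>riesz_separated\<close>), and that the gradation is orthogonal,
  which holds because an endomorphism that shifts degrees has trace zero (\<open>lin_trace_shift\<close>).

  From the group one needs three facts: \<open>Ad\<close> is multiplicative, \<open>Ad a\<close> preserves the bracket, and
  \<open>Ad a\<close> preserves the Lie algebra of \<open>Q\<close> for \<open>a \<in> Q\<close>. All three come from differentiating an
  identity between conjugations at the identity element (\<open>Ad_in_chart_mult\<close>,
  \<open>bracket_Ad_in_chart\<close>, \<open>Ad_in_chart_subgroup\<close>). The analytic input is the chain rule in charts,
  together with the differentiability of \<open>Ad\<close> itself (\<open>Ad_in_chart_differentiable\<close>).
\<close>

section \<open>Multilinear maps on tuples\<close>

definition tuples :: "'a set \<Rightarrow> nat \<Rightarrow> 'a list set" where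
  "tuples E k = {xs. length xs = k \<and> set xs \<subseteq> E}"

lemma tuples_0: "tuples E 0 = {[]}"
  by (auto simp: tuples_def)

lemma sum_tuples_Suc:
  "(\<Sum>zs\<in>tuples E (Suc k). f zs) = (\<Sum>e\<in>E. \<Sum>ys\<in>tuples E k. f (e # ys))"
proof -
  have "tuples E (Suc k) = (\<lambda>(e, ys). e # ys) ` (E \<times> tuples E k)"
    by (fastforce simp: tuples_def length_Suc_conv image_iff)
  moreover have "inj_on (\<lambda>(e, ys). e # ys) (E \<times> tuples E k)"
    by (auto simp: inj_on_def)
  ultimately show ?thesis
    by (simp add: sum.reindex sum.cartesian_product case_prod_unfold)
qed

lemma finite_tuples: "finite E \<Longrightarrow> finite (tuples E k)"
  unfolding tuples_def using finite_lists_length_eq[of E k] by (simp add: conj_commute)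

definition multilinear_on ::
    "'h::real_vector set \<Rightarrow> nat \<Rightarrow> ('h list \<Rightarrow> 'b::real_vector) \<Rightarrow> bool" where
  "multilinear_on V k \<phi> \<longleftrightarrow>
     (\<forall>xs i x y a b. length xs = k \<and> set xs \<subseteq> V \<and> i < k \<and> x \<in> V \<and> y \<in> V \<longrightarrow>
        \<phi> (xs[i := a *\<^sub>R x + b *\<^sub>R y]) = a *\<^sub>R \<phi> (xs[i := x]) + b *\<^sub>R \<phi> (xs[i := y]))"

lemma multilinear_onD:
  assumes "multilinear_on V k \<phi>" "length xs = k" "set xs \<subseteq> V" "i < k" "x \<in> V" "y \<in> V"
  shows "\<phi> (xs[i := a *\<^sub>R x + b *\<^sub>R y]) = a *\<^sub>R \<phi> (xs[i := x]) + b *\<^sub>R \<phi> (xs[i := y])"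
  using assms unfolding multilinear_on_def by blast

lemma multilinear_on_Cons:
  assumes "multilinear_on V (Suc k) \<phi>" "x \<in> V"
  shows "multilinear_on V k (\<lambda>xs. \<phi> (x # xs))"
  unfolding multilinear_on_def
proof (intro allI impI, elim conjE)
  fix xs i u v a b
  assume "length xs = k" "set xs \<subseteq> V" "i < k" "u \<in> V" "v \<in> V"
  then show "\<phi> (x # xs[i := a *\<^sub>R u + b *\<^sub>R v]) = a *\<^sub>R \<phi> (x # xs[i := u]) + b *\<^sub>R \<phi> (x # xs[i := v])"
    using multilinear_onD[OF assms(1), of "x # xs" "Suc i" u v a b] assms(2) by simp
qed

lemma multilinear_on_sum_first:
  assumes \<phi>: "multilinear_on V (Suc k) \<phi>" and V: "subspace V"
    and E: "finite E" "E \<subseteq> V" and xs: "length xs = k" "set xs \<subseteq> V"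
  shows "\<phi> ((\<Sum>e\<in>E. c e *\<^sub>R e) # xs) = (\<Sum>e\<in>E. c e *\<^sub>R \<phi> (e # xs))"
  using E
proof (induction E)
  case empty
  show ?case
    using multilinear_onD[OF \<phi>, of "0 # xs" 0 0 0 0 0] xs subspace_0[OF V] by simp
next
  case (insert e E)
  have "(\<Sum>e\<in>E. c e *\<^sub>R e) \<in> V"
    using insert.prems by (intro subspace_sum[OF V] subspace_scale[OF V]) auto
  then show ?case
    using multilinear_onD[OF \<phi>, of "0 # xs" 0 e "\<Sum>e\<in>E. c e *\<^sub>R e" "c e" 1]
      insert xs subspace_0[OF V] by simp
qed

lemma cochains_iff:
  "\<phi> \<in> cochains V k \<longleftrightarrow>
     (\<forall>xs. \<not> (length xs = k \<and> set xs \<subseteq> V) \<longrightarrow> \<phi> xs = 0) \<and> multilinear_on V k \<phi> \<and>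
     (\<forall>xs i j. length xs = k \<and> set xs \<subseteq> V \<and> i < j \<and> j < k \<and> xs ! i = xs ! j \<longrightarrow> \<phi> xs = 0)"
  by (simp only: cochains_def multilinear_on_def mem_Collect_eq)

lemma multilinear_on_cochain: "\<phi> \<in> cochains V k \<Longrightarrow> multilinear_on V k \<phi>"
  by (simp add: cochains_iff)

lemma cochain_eq_0: "\<phi> \<in> cochains V k \<Longrightarrow> xs \<notin> tuples V k \<Longrightarrow> \<phi> xs = 0"
  by (auto simp: cochains_iff tuples_def)

lemma cochains_zero: "(\<lambda>xs. 0) \<in> cochains V k"
  by (simp add: cochains_def)

lemma cochains_lincomb:
  assumes "\<phi> \<in> cochains V k" "\<psi> \<in> cochains V k"
  shows "(\<lambda>xs. a *\<^sub>R \<phi> xs + b *\<^sub>R \<psi> xs) \<in> cochains V k"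
  unfolding cochains_iff
proof (intro conjI)
  have *: "multilinear_on V k \<phi>" "multilinear_on V k \<psi>"
    using assms by (simp_all add: cochains_iff)
  show "multilinear_on V k (\<lambda>xs. a *\<^sub>R \<phi> xs + b *\<^sub>R \<psi> xs)"
    unfolding multilinear_on_def
    by (intro allI impI, elim conjE)
      (simp add: multilinear_onD[OF *(1)] multilinear_onD[OF *(2)] scaleR_right_distrib mult.commute)
qed (use assms in \<open>simp_all add: cochains_iff\<close>)

section \<open>Euclidean metrics\<close>

context
  fixes g :: "'h::real_vector \<Rightarrow> 'h \<Rightarrow> real"
  assumes g: "euclidean_metric g"
begin

lemma metric_linear_left: "linear (\<lambda>x. g x y)" and metric_linear_right: "linear (g x)"
  and metric_commute: "g x y = g y x" and metric_pos: "x \<noteq> 0 \<Longrightarrow> g x x > 0"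
  using g by (auto simp: euclidean_metric_def)

lemma metric_lincomb_left: "g (a *\<^sub>R x + b *\<^sub>R y) z = a * g x z + b * g y z"
  using linear_add[OF metric_linear_left] linear_scale[OF metric_linear_left] by simp

lemma metric_0_left: "g 0 y = 0"
  using linear_0[OF metric_linear_left] .

text \<open>
  Gram-Schmidt for the metric \<open>g\<close>, one spanning vector at a time.
\<close>

lemma orthonormal_basis_exists:
  assumes "finite S"
  shows "\<exists>E. orthonormal_basis g (span S) E"
  using assms
proof (induction S)
  case empty
  show ?case by (intro exI[of _ "{}"]) (simp add: orthonormal_basis_def)
next
  case (insert v S)
  then obtain E where E0: "orthonormal_basis g (span S) E" by blast
  then have E: "finite E" "E \<subseteq> span S" "span E = span S"
      "\<And>x y. x \<in> E \<Longrightarrow> y \<in> E \<Longrightarrow> g x y = (if x = y then 1 else 0)"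
    by (simp_all add: orthonormal_basis_def)
  define p where "p = (\<Sum>e\<in>E. g v e *\<^sub>R e)"
  define w where "w = v - p"
  have p: "p \<in> span E"
    unfolding p_def by (intro span_sum span_scale span_base)
  have perp: "g w e = 0" if "e \<in> E" for e
  proof -
    have "g p e = (\<Sum>d\<in>E. g v d * g d e)"
      unfolding p_def by (simp add: linear_sum[OF metric_linear_left] linear_scale[OF metric_linear_left])
    also have "\<dots> = (\<Sum>d\<in>E. if d = e then g v e else 0)"
      using that by (intro sum.cong) (auto simp: E(4))
    also have "\<dots> = g v e"
      using that E(1) by simp
    finally show ?thesis
      by (simp add: w_def linear_diff[OF metric_linear_left])
  qed
  show ?case
  proof (cases "w = 0")
    case True
    then have "v \<in> span S" using p E(3) by (simp add: w_def)
    then have "span (insert v S) = span S" by (rule span_redundant)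
    then show ?thesis using E0 by auto
  next
    case False
    define u where "u = (1 / sqrt (g w w)) *\<^sub>R w"
    have gw: "g w w > 0" using metric_pos[OF False] .
    have uu: "g u u = 1"
      using gw unfolding u_def
      by (simp add: linear_scale[OF metric_linear_left] linear_scale[OF metric_linear_right])
    have ue: "g u e = 0" "g e u = 0" if "e \<in> E" for e
      using perp[OF that] metric_commute[of u e]
      unfolding u_def by (simp_all add: linear_scale[OF metric_linear_left])
    have "span (insert u E) = span (insert v S)"
    proof (rule span_eq[THEN iffD2], intro conjI)
      have "span S \<subseteq> span (insert v S)" by (intro span_mono) auto
      then have "p \<in> span (insert v S)" "E \<subseteq> span (insert v S)" using p E(2,3) by auto
      then show "insert u E \<subseteq> span (insert v S)"
        unfolding u_def w_def
        by (auto intro!: span_scale span_diff span_base[of v])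
      have "v = sqrt (g w w) *\<^sub>R u + p"
        using gw by (simp add: u_def w_def)
      moreover have "p \<in> span (insert u E)" using p span_mono[of E "insert u E"] by blast
      ultimately have "v \<in> span (insert u E)"
        by (metis span_add span_scale span_base insertI1)
      moreover have "S \<subseteq> span (insert u E)"
        using span_superset[of S] E(3) span_mono[of E "insert u E"] by blast
      ultimately show "insert v S \<subseteq> span (insert u E)" by blast
    qed
    moreover have "insert u E \<subseteq> span (insert u E)" by (rule span_superset)
    moreover have "g x y = (if x = y then 1 else 0)" if "x \<in> insert u E" "y \<in> insert u E" for x y
      using that uu ue E(4) by auto
    ultimately have "orthonormal_basis g (span (insert v S)) (insert u E)"
      using E(1) by (simp add: orthonormal_basis_def)
    then show ?thesis by blast
  qed
qed

lemma orthonormal_expansion: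
  assumes E: "orthonormal_basis g V E" and "x \<in> V"
  shows "x = (\<Sum>e\<in>E. g x e *\<^sub>R e)"
proof -
  have E': "finite E" "\<And>x y. x \<in> E \<Longrightarrow> y \<in> E \<Longrightarrow> g x y = (if x = y then 1 else 0)"
    using E by (auto simp: orthonormal_basis_def)
  from assms obtain u where u: "x = (\<Sum>e\<in>E. u e *\<^sub>R e)"
    unfolding orthonormal_basis_def using span_finite[of E] by auto
  have "g x e = u e" if "e \<in> E" for e
  proof -
    have "g x e = (\<Sum>d\<in>E. u d * g d e)"
      unfolding u by (simp add: linear_sum[OF metric_linear_left] linear_scale[OF metric_linear_left])
    also have "\<dots> = (\<Sum>d\<in>E. if d = e then u e else 0)"
      using that by (intro sum.cong) (auto simp: E'(2))
    also have "\<dots> = u e" using that E'(1) by simp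
    finally show ?thesis .
  qed
  then show ?thesis using u by simp
qed

abbreviation tuple_metric :: "'h list \<Rightarrow> 'h list \<Rightarrow> real" where
  "tuple_metric xs ys \<equiv> prod_list (map2 g xs ys)"

text \<open>
  Expanding one argument after the other in the basis reduces everything below to sums over tuples
  of basis vectors: a multilinear map is determined by its values there, and precomposing it with a
  linear map changes only the coefficients \<open>tuple_metric\<close>.
\<close>

lemma multilinear_expansion:
  assumes E: "orthonormal_basis g V E" and V: "subspace V"
    and "multilinear_on V k \<phi>" "xs \<in> tuples V k"
  shows "\<phi> xs = (\<Sum>ys\<in>tuples E k. tuple_metric xs ys *\<^sub>R \<phi> ys)"
  using assms(3,4)
proof (induction k arbitrary: \<phi> xs)
  case 0
  then show ?case by (simp add: tuples_0)
next
  case (Suc k)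
  have E': "finite E" "E \<subseteq> V" using E by (auto simp: orthonormal_basis_def)
  obtain x zs where xs: "xs = x # zs" "x \<in> V" "zs \<in> tuples V k"
    using Suc.prems(2) by (auto simp: tuples_def length_Suc_conv)
  have "\<phi> xs = \<phi> ((\<Sum>e\<in>E. g x e *\<^sub>R e) # zs)"
    using orthonormal_expansion[OF E xs(2)] xs(1) by simp
  also have "\<dots> = (\<Sum>e\<in>E. g x e *\<^sub>R \<phi> (e # zs))"
    using multilinear_on_sum_first[OF Suc.prems(1) V E'] xs(3) by (simp add: tuples_def)
  also have "\<dots> = (\<Sum>e\<in>E. g x e *\<^sub>R (\<Sum>ys\<in>tuples E k. tuple_metric zs ys *\<^sub>R \<phi> (e # ys)))"
    using E'(2) multilinear_on_Cons[OF Suc.prems(1)]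
    by (intro sum.cong refl arg_cong[where f = "scaleR _"] Suc.IH[OF _ xs(3)]) auto
  also have "\<dots> = (\<Sum>ys\<in>tuples E (Suc k). tuple_metric xs ys *\<^sub>R \<phi> ys)"
    by (simp add: sum_tuples_Suc xs(1) scaleR_sum_right)
  finally show ?case .
qed

end

section \<open>Representing linear functionals\<close>

text \<open>
  The Riesz representation theorem for a space \<open>W\<close> of functions that is finite dimensional because
  finitely many coordinate evaluations separate its elements. By induction on the set of
  evaluations: the elements on which one evaluation vanishes form a subspace \<open>W0\<close> of codimension at
  most one, a vector outside \<open>W0\<close> is made orthogonal to \<open>W0\<close> with the help of the induction
  hypothesis, and then a multiple of it corrects the representing vector of \<open>W0\<close>.
\<close>

lemma riesz_separated:
  fixes W :: "('a \<Rightarrow> 'b::euclidean_space) set"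
  assumes "finite F"
    and "(\<lambda>x. 0) \<in> W"
    and "\<And>u v a b. u \<in> W \<Longrightarrow> v \<in> W \<Longrightarrow> (\<lambda>x. a *\<^sub>R u x + b *\<^sub>R v x) \<in> W"
    and "\<And>u v. u \<in> W \<Longrightarrow> v \<in> W \<Longrightarrow> ip u v = ip v u"
    and "\<And>u v w a b. u \<in> W \<Longrightarrow> v \<in> W \<Longrightarrow> w \<in> W \<Longrightarrow>
           ip (\<lambda>x. a *\<^sub>R u x + b *\<^sub>R v x) w = a * ip u w + b * ip v w"
    and "\<And>u. u \<in> W \<Longrightarrow> u \<noteq> (\<lambda>x. 0) \<Longrightarrow> ip u u > (0::real)"
    and "\<And>u v a b. u \<in> W \<Longrightarrow> v \<in> W \<Longrightarrow> L (\<lambda>x. a *\<^sub>R u x + b *\<^sub>R v x) = a * L u + b * L v"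
    and "\<And>u. u \<in> W \<Longrightarrow> (\<And>t c. (t, c) \<in> F \<Longrightarrow> u t \<bullet> c = 0) \<Longrightarrow> u = (\<lambda>x. 0)"
  shows "\<exists>\<psi>\<in>W. \<forall>\<eta>\<in>W. L \<eta> = ip \<eta> \<psi>"
  using assms
proof (induction F arbitrary: W L)
  case empty
  have L0: "L (\<lambda>x. 0) = 0" and ip0: "ip (\<lambda>x. 0) (\<lambda>x. 0) = 0"
    using empty.prems(6)[of "\<lambda>x. 0" "\<lambda>x. 0" 0 0] empty.prems(4)[of "\<lambda>x. 0" "\<lambda>x. 0" "\<lambda>x. 0" 0 0]
      empty.prems(1) by auto
  have "\<eta> = (\<lambda>x. 0)" if "\<eta> \<in> W" for \<eta>
    using empty.prems(7)[OF that] by simp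
  then show ?case
    using empty.prems(1) L0 ip0 by metis
next
  case (insert p F)
  obtain t c where p: "p = (t, c)" by (cases p)
  define W0 where "W0 = {u \<in> W. u t \<bullet> c = 0}"
  note zero = insert.prems(1) and comb = insert.prems(2) and sym = insert.prems(3)
    and bil = insert.prems(4) and pos = insert.prems(5) and Llin = insert.prems(6)
  have W0W: "u \<in> W" if "u \<in> W0" for u using that by (simp add: W0_def)
  have IH: "\<exists>\<psi>\<in>W0. \<forall>\<eta>\<in>W0. M \<eta> = ip \<eta> \<psi>"
    if M: "\<forall>u\<in>W. \<forall>v\<in>W. \<forall>a b. M (\<lambda>x. a *\<^sub>R u x + b *\<^sub>R v x) = a * M u + b * M v" for M
  proof (rule insert.IH)
    show "(\<lambda>x. 0) \<in> W0" using zero by (simp add: W0_def)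
    show "(\<lambda>x. a *\<^sub>R u x + b *\<^sub>R v x) \<in> W0" if "u \<in> W0" "v \<in> W0" for u v a b
      using that comb by (simp add: W0_def inner_add_left)
    show "u = (\<lambda>x. 0)" if "u \<in> W0" "\<And>t c. (t, c) \<in> F \<Longrightarrow> u t \<bullet> c = 0" for u
      using that by (intro insert.prems(7)) (auto simp: W0_def p)
    show "ip u v = ip v u" if "u \<in> W0" "v \<in> W0" for u v
      using sym[OF W0W W0W] that .
    show "ip (\<lambda>x. a *\<^sub>R u x + b *\<^sub>R v x) w = a * ip u w + b * ip v w"
      if "u \<in> W0" "v \<in> W0" "w \<in> W0" for u v w a b
      using bil[OF W0W W0W W0W] that .
    show "ip u u > 0" if "u \<in> W0" "u \<noteq> (\<lambda>x. 0)" for u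
      using pos[OF W0W] that .
    show "M (\<lambda>x. a *\<^sub>R u x + b *\<^sub>R v x) = a * M u + b * M v"
      if "u \<in> W0" "v \<in> W0" for u v a b
      using M W0W that by blast
  qed
  have IHL: "\<exists>\<psi>\<in>W0. \<forall>\<eta>\<in>W0. L \<eta> = ip \<eta> \<psi>"
    by (rule IH) (intro ballI allI Llin)
  show ?case
  proof (cases "W0 = W")
    case True
    then show ?thesis using IHL by simp
  next
    case False
    then obtain w1 where w1: "w1 \<in> W" "w1 t \<bullet> c \<noteq> 0" by (auto simp: W0_def)
    \<comment> \<open>The vector representing \<open>ip _ w1\<close> is the orthogonal projection of \<open>w1\<close> to \<open>W0\<close>.\<close>
    have "\<exists>\<psi>\<in>W0. \<forall>\<eta>\<in>W0. ip \<eta> w1 = ip \<eta> \<psi>"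
      by (rule IH) (intro ballI allI bil w1(1))
    then obtain q where q: "q \<in> W0" "\<And>\<eta>. \<eta> \<in> W0 \<Longrightarrow> ip \<eta> w1 = ip \<eta> q" by blast
    obtain \<psi>0 where \<psi>0: "\<psi>0 \<in> W0" "\<And>\<eta>. \<eta> \<in> W0 \<Longrightarrow> L \<eta> = ip \<eta> \<psi>0" using IHL by blast
    define w where "w = (\<lambda>x. 1 *\<^sub>R w1 x + (-1) *\<^sub>R q x)"
    have w: "w \<in> W" unfolding w_def using w1(1) W0W[OF q(1)] by (rule comb)
    have wt: "w t \<bullet> c \<noteq> 0"
      using w1(2) q(1) by (simp add: w_def W0_def inner_diff_left)
    have ip_w: "ip w \<eta> = 0" "ip \<eta> w = 0" if "\<eta> \<in> W0" for \<eta>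
    proof -
      show "ip w \<eta> = 0"
        using bil[OF w1(1) W0W[OF q(1)] W0W[OF that], of 1 "-1"] q(2)[OF that]
          sym[OF w1(1) W0W[OF that]] sym[OF W0W[OF q(1)] W0W[OF that]] by (simp add: w_def)
      then show "ip \<eta> w = 0" using sym[OF w W0W[OF that]] by simp
    qed
    have ww: "ip w w > 0" using wt by (intro pos w) auto
    define \<psi> where "\<psi> = (\<lambda>x. 1 *\<^sub>R \<psi>0 x + (L w / ip w w) *\<^sub>R w x)"
    have \<psi>: "\<psi> \<in> W" unfolding \<psi>_def using W0W[OF \<psi>0(1)] w by (rule comb)
    have ip_\<psi>: "ip \<eta> \<psi> = ip \<eta> \<psi>0 + (L w / ip w w) * ip \<eta> w" if "\<eta> \<in> W" for \<eta>
      using bil[OF W0W[OF \<psi>0(1)] w that, of 1 "L w / ip w w"]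
        sym[OF that \<psi>] sym[OF that W0W[OF \<psi>0(1)]] sym[OF that w] by (simp add: \<psi>_def)
    have "L \<eta> = ip \<eta> \<psi>" if \<eta>: "\<eta> \<in> W" for \<eta>
    proof -
      define s where "s = \<eta> t \<bullet> c / (w t \<bullet> c)"
      define \<eta>0 where "\<eta>0 = (\<lambda>x. 1 *\<^sub>R \<eta> x + (-s) *\<^sub>R w x)"
      have \<eta>0: "\<eta>0 \<in> W0"
        using comb[OF \<eta> w, of 1 "-s"] wt by (simp add: \<eta>0_def W0_def s_def inner_diff_left)
      have dec: "\<eta> = (\<lambda>x. 1 *\<^sub>R \<eta>0 x + s *\<^sub>R w x)" by (simp add: \<eta>0_def)
      have "L \<eta> = L \<eta>0 + s * L w"
        using arg_cong[OF dec, of L] Llin[OF W0W[OF \<eta>0] w, of 1 s] by linarith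
      moreover have "ip \<eta> \<psi> = ip \<eta>0 \<psi> + s * ip w \<psi>"
        using arg_cong[OF dec, of "\<lambda>u. ip u \<psi>"] bil[OF W0W[OF \<eta>0] w \<psi>, of 1 s] by linarith
      moreover have "ip \<eta>0 \<psi> = L \<eta>0"
        using ip_\<psi>[OF W0W[OF \<eta>0]] \<psi>0(2)[OF \<eta>0] ip_w(2)[OF \<eta>0] by simp
      moreover have "ip w \<psi> = L w"
        using ip_\<psi>[OF w] ip_w(1)[OF \<psi>0(1)] ww by simp
      ultimately show ?thesis by simp
    qed
    then show ?thesis using \<psi> by blast
  qed
qed

section \<open>The codifferential\<close>

text \<open>
  The coboundary omits arguments with \<^const>\<open>nths\<close>; this tracks where an updated entry ends up, from
  which the multilinearity of each term of the coboundary follows.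
\<close>

lemma nths_list_update:
  "nths (xs[p := x]) I =
     (if p \<in> I then (nths xs I)[card {q \<in> I. q < p} := x] else nths xs I)"
proof (induction xs arbitrary: p I)
  case Nil
  then show ?case by simp
next
  case (Cons y ys)
  show ?case
  proof (cases p)
    case 0
    then show ?thesis by (simp add: nths_Cons)
  next
    case (Suc r)
    have "{q \<in> I. q < Suc r} = (if 0 \<in> I then {0} else {}) \<union> Suc ` {q \<in> {j. Suc j \<in> I}. q < r}"
      by (auto simp: image_iff) (metis not0_implies_Suc Suc_less_eq)+
    moreover have "card ((if 0 \<in> I then {0} else {}) \<union> Suc ` {q \<in> {j. Suc j \<in> I}. q < r}) =
        (if 0 \<in> I then 1 else 0) + card {q \<in> {j. Suc j \<in> I}. q < r}"
      by (simp add: card_image)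
    ultimately show ?thesis
      using Suc Cons.IH[of r "{j. Suc j \<in> I}"] by (simp add: nths_Cons)
  qed
qed

lemma length_nths_Compl:
  assumes "J \<subseteq> {..<length xs}"
  shows "length (nths xs (- J)) = length xs - card J"
proof -
  have "{i. i < length xs \<and> i \<in> - J} = {..<length xs} - J" by auto
  then show ?thesis
    using assms finite_subset[OF assms] by (simp add: length_nths card_Diff_subset)
qed

lemma card_less_nths:
  assumes "p \<in> I" "p < length xs"
  shows "card {q \<in> I. q < p} < length (nths xs I)"
proof -
  have "{q \<in> I. q < p} \<subset> {i. i < length xs \<and> i \<in> I}" using assms by auto
  then show ?thesis unfolding length_nths by (intro psubset_card_mono) auto
qed

lemma multilinear_on_add:
  "multilinear_on V k \<phi> \<Longrightarrow> multilinear_on V k \<psi> \<Longrightarrow> multilinear_on V k (\<lambda>xs. \<phi> xs + \<psi> xs)"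
  unfolding multilinear_on_def by (simp add: algebra_simps)

lemma multilinear_on_scaleR:
  "multilinear_on V k \<phi> \<Longrightarrow> multilinear_on V k (\<lambda>xs. c *\<^sub>R \<phi> xs)"
  unfolding multilinear_on_def by (simp add: algebra_simps)

lemma multilinear_on_sum:
  assumes "\<And>i. i \<in> S \<Longrightarrow> multilinear_on V k (\<phi> i)"
  shows "multilinear_on V k (\<lambda>xs. \<Sum>i\<in>S. \<phi> i xs)"
  unfolding multilinear_on_def
  by (intro allI impI, elim conjE)
    (simp add: multilinear_onD[OF assms] sum.distrib scaleR_sum_right cong: sum.cong)

lemma multilinear_on_linear_comp:
  "linear f \<Longrightarrow> multilinear_on V k \<phi> \<Longrightarrow> multilinear_on V k (\<lambda>xs. f (\<phi> xs))"
  unfolding multilinear_on_def by (simp add: linear_add linear_scale)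

lemma multilinear_on_cong:
  assumes V: "subspace V" and "multilinear_on V k \<phi>"
    and eq: "\<And>xs. length xs = k \<Longrightarrow> set xs \<subseteq> V \<Longrightarrow> \<phi> xs = \<psi> xs"
  shows "multilinear_on V k \<psi>"
  unfolding multilinear_on_def
proof (intro allI impI, elim conjE)
  fix xs i x y a b
  assume *: "length xs = k" "set xs \<subseteq> V" "i < k" "x \<in> V" "y \<in> V"
  have upd: "set (xs[i := z]) \<subseteq> V" if "z \<in> V" for z
    using that *(2) set_update_subset_insert[of xs i z] by blast
  have "a *\<^sub>R x + b *\<^sub>R y \<in> V" using * V by (simp add: subspace_add subspace_scale)
  from upd[OF this] upd[OF *(4)] upd[OF *(5)]
  show "\<psi> (xs[i := a *\<^sub>R x + b *\<^sub>R y]) = a *\<^sub>R \<psi> (xs[i := x]) + b *\<^sub>R \<psi> (xs[i := y])"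
    using multilinear_onD[OF assms(2) *, of a b] *(1) by (simp add: eq)
qed

lemma linear_ad: "lie_algebra br \<Longrightarrow> linear (br x)"
  and linear_ad_left: "lie_algebra br \<Longrightarrow> linear (\<lambda>x. br x y)"
  by (auto simp: lie_algebra_def)

text \<open>
  Both the action of the group on cochains and its metric adjoint have this form. In the first case
  \<open>D\<close> is not an automorphism but the compression of one to \<open>V\<close>, so \<open>C\<close> and \<open>D\<close> are kept independent.
\<close>

definition transport :: "
    'h::real_vector set \<Rightarrow> ('h \<Rightarrow> 'h) \<Rightarrow> ('h \<Rightarrow> 'h) \<Rightarrow> ('h list \<Rightarrow> 'h) \<Rightarrow> 'h list \<Rightarrow> 'h" where
  "transport V C D \<phi> xs = (if set xs \<subseteq> V then C (\<phi> (map D xs)) else 0)"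

context
  fixes br :: "'h::euclidean_space \<Rightarrow> 'h \<Rightarrow> 'h" and V :: "'h set"
  assumes br: "lie_algebra br" and V: "lie_subalgebra br V"
begin

lemma lie_subalgebra_subspace: "subspace V" and bracket_closed: "x \<in> V \<Longrightarrow> y \<in> V \<Longrightarrow> br x y \<in> V"
  using V by (auto simp: lie_subalgebra_def)

lemma bracket_lincomb_right: "br z (a *\<^sub>R x + b *\<^sub>R y) = a *\<^sub>R br z x + b *\<^sub>R br z y"
  by (simp add: linear_add[OF linear_ad[OF br]] linear_scale[OF linear_ad[OF br]])

lemma bracket_lincomb_left: "br (a *\<^sub>R x + b *\<^sub>R y) z = a *\<^sub>R br x z + b *\<^sub>R br y z"
  using linear_add[OF linear_ad_left[OF br]] linear_scale[OF linear_ad_left[OF br]] by simp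

lemma multilinear_on_bracket_nth:
  assumes \<phi>: "multilinear_on V k \<phi>" and i: "i \<le> k"
  shows "multilinear_on V (Suc k) (\<lambda>xs. br (xs ! i) (\<phi> (nths xs (- {i}))))"
  unfolding multilinear_on_def
proof (intro allI impI, elim conjE)
  fix xs p x y a b
  assume xs: "length xs = Suc k" "set xs \<subseteq> V" and p: "p < Suc k" and xy: "x \<in> V" "y \<in> V"
  define zs where "zs = nths xs (- {i})"
  define r where "r = card {q \<in> - {i}. q < p}"
  have zs: "length zs = k" "set zs \<subseteq> V"
    using xs i length_nths_Compl[of "{i}" xs] set_nths_subset[of xs "- {i}"]
    unfolding zs_def by auto
  show "br (xs[p := a *\<^sub>R x + b *\<^sub>R y] ! i) (\<phi> (nths (xs[p := a *\<^sub>R x + b *\<^sub>R y]) (- {i}))) =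
      a *\<^sub>R br (xs[p := x] ! i) (\<phi> (nths (xs[p := x]) (- {i}))) +
      b *\<^sub>R br (xs[p := y] ! i) (\<phi> (nths (xs[p := y]) (- {i})))"
  proof (cases "p = i")
    case True
    then show ?thesis
      using xs p by (simp add: nths_list_update bracket_lincomb_left)
  next
    case False
    then have "r < k"
      using card_less_nths[of p "- {i}" xs] p xs zs unfolding r_def zs_def by simp
    moreover have "nths (xs[p := z]) (- {i}) = zs[r := z]" "xs[p := z] ! i = xs ! i" for z
      using False by (simp_all add: nths_list_update r_def zs_def)
    ultimately show ?thesis
      by (simp add: multilinear_onD[OF \<phi> zs _ xy] bracket_lincomb_right)
  qed
qed

lemma multilinear_on_bracket_insert:
  assumes \<phi>: "multilinear_on V k \<phi>" and ij: "i < j" "j \<le> k"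
  shows "multilinear_on V (Suc k) (\<lambda>xs. \<phi> (br (xs ! i) (xs ! j) # nths xs (- {i, j})))"
  unfolding multilinear_on_def
proof (intro allI impI, elim conjE)
  fix xs p x y a b
  assume xs: "length xs = Suc k" "set xs \<subseteq> V" and p: "p < Suc k" and xy: "x \<in> V" "y \<in> V"
  define zs where "zs = nths xs (- {i, j})"
  define r where "r = card {q \<in> - {i, j}. q < p}"
  have zs: "Suc (length zs) = k" "set zs \<subseteq> V"
    using xs ij length_nths_Compl[of "{i, j}" xs] set_nths_subset[of xs "- {i, j}"]
    unfolding zs_def by auto
  have nth: "xs ! i \<in> V" "xs ! j \<in> V"
    using xs ij nth_mem[of i xs] nth_mem[of j xs] by auto
  have first: "\<phi> ((a *\<^sub>R u + b *\<^sub>R v) # zs) = a *\<^sub>R \<phi> (u # zs) + b *\<^sub>R \<phi> (v # zs)"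
    if "u \<in> V" "v \<in> V" for u v
    using multilinear_onD[OF \<phi>, of "0 # zs" 0 u v a b] zs that subspace_0[OF lie_subalgebra_subspace] by simp
  consider "p = i" | "p = j" | "p \<noteq> i" "p \<noteq> j" by blast
  then show "\<phi> (br (xs[p := a *\<^sub>R x + b *\<^sub>R y] ! i) (xs[p := a *\<^sub>R x + b *\<^sub>R y] ! j) #
        nths (xs[p := a *\<^sub>R x + b *\<^sub>R y]) (- {i, j})) =
      a *\<^sub>R \<phi> (br (xs[p := x] ! i) (xs[p := x] ! j) # nths (xs[p := x]) (- {i, j})) +
      b *\<^sub>R \<phi> (br (xs[p := y] ! i) (xs[p := y] ! j) # nths (xs[p := y]) (- {i, j}))"
  proof cases
    case 1
    then show ?thesis
      using xs p ij xy nth by (simp add: nths_list_update bracket_lincomb_left first bracket_closed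
          flip: zs_def)
  next
    case 2
    then show ?thesis
      using xs p ij xy nth by (simp add: nths_list_update bracket_lincomb_right first bracket_closed
          flip: zs_def)
  next
    case 3
    then have r: "Suc r < k"
      using card_less_nths[of p "- {i, j}" xs] p xs zs unfolding r_def zs_def by simp
    have "set (br (xs ! i) (xs ! j) # zs) \<subseteq> V" using zs nth by (simp add: bracket_closed)
    from multilinear_onD[OF \<phi> _ this r xy, of a b] zs
    have "\<phi> (br (xs ! i) (xs ! j) # zs[r := a *\<^sub>R x + b *\<^sub>R y]) =
        a *\<^sub>R \<phi> (br (xs ! i) (xs ! j) # zs[r := x]) + b *\<^sub>R \<phi> (br (xs ! i) (xs ! j) # zs[r := y])"
      by simp
    moreover have "nths (xs[p := z]) (- {i, j}) = zs[r := z]" for z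
      using 3 by (simp add: nths_list_update r_def zs_def)
    ultimately show ?thesis using 3 by simp
  qed
qed

text \<open>
  This allows a coboundary to be expanded in a basis, which is how the adjoint of an action on
  cochains is computed.
\<close>

lemma multilinear_on_coboundary:
  assumes "multilinear_on V k \<phi>"
  shows "multilinear_on V (Suc k) (coboundary br V k \<phi>)"
proof (rule multilinear_on_cong[OF lie_subalgebra_subspace])
  show "multilinear_on V (Suc k) (\<lambda>xs. (\<Sum>i\<le>k. (-1) ^ i *\<^sub>R br (xs ! i) (\<phi> (nths xs (- {i})))) +
      (\<Sum>j\<le>k. \<Sum>i<j. (-1) ^ (i + j) *\<^sub>R \<phi> (br (xs ! i) (xs ! j) # nths xs (- {i, j}))))"
    using assms
    by (intro multilinear_on_add multilinear_on_sum multilinear_on_scaleR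
        multilinear_on_bracket_nth multilinear_on_bracket_insert) auto
qed (simp add: coboundary_def)

lemma coboundary_lincomb:
  "coboundary br V k (\<lambda>xs. a *\<^sub>R \<phi> xs + b *\<^sub>R \<psi> xs) xs =
     a *\<^sub>R coboundary br V k \<phi> xs + b *\<^sub>R coboundary br V k \<psi> xs"
  by (simp add: coboundary_def bracket_lincomb_right scaleR_right_distrib sum.distrib
      scaleR_sum_right ac_simps)

lemma transport_cochain:
  assumes C: "linear C" and D: "linear D" "\<And>x. x \<in> V \<Longrightarrow> D x \<in> V" and \<phi>: "\<phi> \<in> cochains V k"
  shows "transport V C D \<phi> \<in> cochains V k"
  unfolding cochains_iff
proof (intro conjI allI impI)
  have \<phi>0: "\<phi> xs = 0" if "\<not> (length xs = k \<and> set xs \<subseteq> V)" for xs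
    using \<phi> that unfolding cochains_iff by blast
  show "transport V C D \<phi> xs = 0" if "\<not> (length xs = k \<and> set xs \<subseteq> V)" for xs
    using that \<phi>0[of "map D xs"] linear_0[OF C] by (auto simp: transport_def)
  have "multilinear_on V k (\<lambda>xs. C (\<phi> (map D xs)))"
  proof (rule multilinear_on_linear_comp[OF C], unfold multilinear_on_def, intro allI impI, elim conjE)
    fix xs i x y a b
    assume *: "length xs = k" "set xs \<subseteq> V" "i < k" "x \<in> V" "y \<in> V"
    then have "set (map D xs) \<subseteq> V" using D(2) by auto
    from multilinear_onD[OF multilinear_on_cochain[OF \<phi>] _ this *(3), of "D x" "D y" a b] D(2) *
    show "\<phi> (map D (xs[i := a *\<^sub>R x + b *\<^sub>R y])) =
        a *\<^sub>R \<phi> (map D (xs[i := x])) + b *\<^sub>R \<phi> (map D (xs[i := y]))"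
      by (simp add: map_update linear_add[OF D(1)] linear_scale[OF D(1)])
  qed
  then show "multilinear_on V k (transport V C D \<phi>)"
    by (rule multilinear_on_cong[OF lie_subalgebra_subspace]) (simp add: transport_def)
  fix xs i j
  assume *: "length xs = k \<and> set xs \<subseteq> V \<and> i < j \<and> j < k \<and> xs ! i = xs ! j"
  then have "\<phi> (map D xs) = 0"
    using \<phi> D(2) unfolding cochains_iff
    by (elim conjE, elim allE[of _ "map D xs"] allE[of _ i] allE[of _ j]) auto
  then show "transport V C D \<phi> xs = 0"
    using linear_0[OF C] by (simp add: transport_def)
qed

text \<open>
  Naturality of the coboundary: it is built from the bracket, which \<open>C\<close> and \<open>D\<close> preserve. Pulling \<open>C\<close>
  out of \<open>br (xs ! i) (C _)\<close> takes \<open>xs ! i = C (D (xs ! i))\<close>.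
\<close>

lemma coboundary_transport:
  assumes C: "linear C" "\<And>x y. C (br x y) = br (C x) (C y)"
    and D: "\<And>x. x \<in> V \<Longrightarrow> D x \<in> V" "\<And>x y. x \<in> V \<Longrightarrow> y \<in> V \<Longrightarrow> D (br x y) = br (D x) (D y)"
    and CD: "\<And>x. x \<in> V \<Longrightarrow> C (D x) = x"
  shows "coboundary br V k (transport V C D \<phi>) = transport V C D (coboundary br V k \<phi>)"
proof
  fix xs
  show "coboundary br V k (transport V C D \<phi>) xs = transport V C D (coboundary br V k \<phi>) xs"
  proof (cases "length xs = Suc k \<and> set xs \<subseteq> V")
    case False
    then show ?thesis
      using linear_0[OF C(1)] by (auto simp: coboundary_def transport_def)
  next
    case True
    have sub: "set (nths xs I) \<subseteq> V" for I
      using True set_nths_subset[of xs I] by blast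
    have nth: "xs ! i \<in> V" if "i \<le> k" for i
      using True that nth_mem[of i xs] by auto
    have br_nth: "br (xs ! i) (xs ! j) \<in> V" if "i < j" "j \<le> k" for i j
      using that nth by (simp add: bracket_closed)
    have "coboundary br V k (transport V C D \<phi>) xs =
        (\<Sum>i\<le>k. (-1) ^ i *\<^sub>R br (xs ! i) (C (\<phi> (map D (nths xs (- {i})))))) +
        (\<Sum>j\<le>k. \<Sum>i<j. (-1) ^ (i + j) *\<^sub>R C (\<phi> (map D (br (xs ! i) (xs ! j) # nths xs (- {i, j})))))"
      using True sub nth by (simp add: coboundary_def transport_def br_nth cong: sum.cong_simp)
    also have "(\<Sum>i\<le>k. (-1) ^ i *\<^sub>R br (xs ! i) (C (\<phi> (map D (nths xs (- {i})))))) =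
        (\<Sum>i\<le>k. C ((-1) ^ i *\<^sub>R br (map D xs ! i) (\<phi> (nths (map D xs) (- {i})))))"
      using True by (intro sum.cong refl) (simp add: C linear_scale CD nth nths_map)
    also have "(\<Sum>j\<le>k. \<Sum>i<j. (-1) ^ (i + j) *\<^sub>R
          C (\<phi> (map D (br (xs ! i) (xs ! j) # nths xs (- {i, j}))))) =
        (\<Sum>j\<le>k. \<Sum>i<j. C ((-1) ^ (i + j) *\<^sub>R
          \<phi> (br (map D xs ! i) (map D xs ! j) # nths (map D xs) (- {i, j}))))"
      using True by (intro sum.cong refl) (simp add: linear_scale[OF C(1)] D(2) nth nths_map)
    also have "(\<Sum>i\<le>k. C ((-1) ^ i *\<^sub>R br (map D xs ! i) (\<phi> (nths (map D xs) (- {i}))))) +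
        (\<Sum>j\<le>k. \<Sum>i<j. C ((-1) ^ (i + j) *\<^sub>R
          \<phi> (br (map D xs ! i) (map D xs ! j) # nths (map D xs) (- {i, j})))) =
        C (coboundary br V k \<phi> (map D xs))"
      using True D(1) by (auto simp: coboundary_def linear_add[OF C(1)] linear_sum[OF C(1)])
    finally show ?thesis using True by (simp only: transport_def[of V C D _ xs] if_True)
  qed
qed

end

context
  fixes g :: "'h::euclidean_space \<Rightarrow> 'h \<Rightarrow> real" and V :: "'h set"
  assumes g: "euclidean_metric g" and V: "subspace V"
begin

lemma cochain_metric_eq:
  obtains E where "orthonormal_basis g V E"
    "\<And>k \<phi> \<psi>. cochain_metric g V k \<phi> \<psi> = (\<Sum>xs\<in>tuples E k. g (\<phi> xs) (\<psi> xs)) / fact k"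
proof -
  define E where "E = (SOME E. orthonormal_basis g V E)"
  obtain S where S: "S \<subseteq> V" "independent S" "V \<subseteq> span S" by (rule maximal_independent_subset)
  have "finite S" "span S = V"
    using independent_imp_finite[OF S(2)] span_subspace[OF S(1,3) V] .
  then have "\<exists>E. orthonormal_basis g V E"
    using orthonormal_basis_exists[OF g, of S] by simp
  then have "orthonormal_basis g V E" unfolding E_def by (rule someI_ex)
  then show thesis
    by (rule that) (simp add: cochain_metric_def Let_def tuples_def E_def)
qed

lemma cochain_metric_pos:
  assumes \<phi>: "\<phi> \<in> cochains V k" and "\<phi> \<noteq> (\<lambda>xs. 0)"
  shows "cochain_metric g V k \<phi> \<phi> > 0"
proof -
  obtain E where E: "orthonormal_basis g V E" and
    metric: "\<And>k \<phi> \<psi>. cochain_metric g V k \<phi> \<psi> = (\<Sum>xs\<in>tuples E k. g (\<phi> xs) (\<psi> xs)) / fact k"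
    by (rule cochain_metric_eq) (rule that)
  have fin: "finite (tuples E k)" using E finite_tuples by (auto simp: orthonormal_basis_def)
  have "\<exists>xs\<in>tuples E k. \<phi> xs \<noteq> 0"
  proof (rule ccontr)
    assume "\<not> ?thesis"
    then have "\<phi> xs = 0" for xs
      using multilinear_expansion[OF g E V multilinear_on_cochain[OF \<phi>], of xs]
        cochain_eq_0[OF \<phi>, of xs] by (cases "xs \<in> tuples V k") auto
    with assms(2) show False by blast
  qed
  then obtain ys where ys: "ys \<in> tuples E k" "g (\<phi> ys) (\<phi> ys) > 0"
    using metric_pos[OF g] by blast
  have nonneg: "g x x \<ge> 0" for x
    using metric_pos[OF g, of x] metric_0_left[OF g, of 0] by (cases "x = 0") auto
  have "(\<Sum>xs\<in>tuples E k. g (\<phi> xs) (\<phi> xs)) > 0"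
    using fin ys nonneg by (intro sum_pos2[of _ ys]) auto
  then show ?thesis by (simp add: metric)
qed

lemma cochain_metric_lincomb:
  "cochain_metric g V k (\<lambda>xs. a *\<^sub>R \<phi> xs + b *\<^sub>R \<psi> xs) \<rho> =
     a * cochain_metric g V k \<phi> \<rho> + b * cochain_metric g V k \<psi> \<rho>"
  by (simp add: cochain_metric_def Let_def metric_lincomb_left[OF g] sum.distrib sum_distrib_left
      add_divide_distrib)

lemma cochain_metric_commute: "cochain_metric g V k \<phi> \<psi> = cochain_metric g V k \<psi> \<phi>"
  unfolding cochain_metric_def Let_def
  by (intro arg_cong[where f = "\<lambda>s. s / _"] sum.cong refl metric_commute[OF g])

lemma cochain_metric_eqI:
  assumes "\<psi>1 \<in> cochains V k" "\<psi>2 \<in> cochains V k"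
    and eq: "\<And>\<eta>. \<eta> \<in> cochains V k \<Longrightarrow> cochain_metric g V k \<eta> \<psi>1 = cochain_metric g V k \<eta> \<psi>2"
  shows "\<psi>1 = \<psi>2"
proof -
  define \<delta> where "\<delta> = (\<lambda>xs. 1 *\<^sub>R \<psi>1 xs + (-1) *\<^sub>R \<psi>2 xs)"
  have \<delta>: "\<delta> \<in> cochains V k" unfolding \<delta>_def using assms(1,2) by (rule cochains_lincomb)
  have "cochain_metric g V k \<delta> \<delta> = cochain_metric g V k \<psi>1 \<delta> - cochain_metric g V k \<psi>2 \<delta>"
    using cochain_metric_lincomb[of k 1 \<psi>1 "-1" \<psi>2 \<delta>] unfolding \<delta>_def[symmetric] by simp
  also have "\<dots> = 0"
    using eq[OF \<delta>] unfolding cochain_metric_commute[of k \<delta>] by simp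
  finally have "\<not> cochain_metric g V k \<delta> \<delta> > 0" by simp
  then have "\<delta> = (\<lambda>xs. 0)" using cochain_metric_pos[OF \<delta>] by blast
  then show ?thesis by (auto simp: \<delta>_def fun_eq_iff)
qed

lemma cochain_functional_represented:
  assumes L: "\<And>\<phi> \<psi> a b. \<phi> \<in> cochains V k \<Longrightarrow> \<psi> \<in> cochains V k \<Longrightarrow>
      L (\<lambda>xs. a *\<^sub>R \<phi> xs + b *\<^sub>R \<psi> xs) = a * L \<phi> + b * L \<psi>"
  shows "\<exists>\<psi>\<in>cochains V k. \<forall>\<eta>\<in>cochains V k. L \<eta> = cochain_metric g V k \<eta> \<psi>"
proof -
  obtain E where E: "orthonormal_basis g V E"
    by (rule cochain_metric_eq)
  show ?thesis
  proof (rule riesz_separated[where F = "tuples E k \<times> Basis" and W = "cochains V k"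
        and L = L and ip = "cochain_metric g V k"])
    show "finite (tuples E k \<times> (Basis :: 'h set))"
      using E by (intro finite_cartesian_product finite_tuples) (auto simp: orthonormal_basis_def)
    fix u assume u: "u \<in> cochains V k"
      and 0: "\<And>t c. (t, c) \<in> tuples E k \<times> Basis \<Longrightarrow> u t \<bullet> c = 0"
    have 0: "u t = 0" if "t \<in> tuples E k" for t
    proof (rule euclidean_eqI)
      show "u t \<bullet> c = 0 \<bullet> c" if "c \<in> Basis" for c
        using 0[of t c] \<open>t \<in> tuples E k\<close> that by simp
    qed
    show "u = (\<lambda>x. 0)"
    proof
      fix xs
      show "u xs = 0"
      proof (cases "xs \<in> tuples V k")
        case True
        show ?thesis
          unfolding multilinear_expansion[OF g E V multilinear_on_cochain[OF u] True]
          by (simp add: 0)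
      qed (rule cochain_eq_0[OF u])
    qed
  next
    fix u v w :: "'h list \<Rightarrow> 'h" and a b :: real
    show "cochain_metric g V k (\<lambda>x. a *\<^sub>R u x + b *\<^sub>R v x) w =
        a * cochain_metric g V k u w + b * cochain_metric g V k v w"
      by (rule cochain_metric_lincomb)
    show "cochain_metric g V k u v = cochain_metric g V k v u"
      by (rule cochain_metric_commute)
    show "(\<lambda>x. a *\<^sub>R u x + b *\<^sub>R v x) \<in> cochains V k" if "u \<in> cochains V k" "v \<in> cochains V k"
      using cochains_lincomb[OF that] .
    show "L (\<lambda>x. a *\<^sub>R u x + b *\<^sub>R v x) = a * L u + b * L v"
      if "u \<in> cochains V k" "v \<in> cochains V k"
      using L[OF that] .
    show "cochain_metric g V k u u > 0" if "u \<in> cochains V k" "u \<noteq> (\<lambda>x. 0)"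
      using cochain_metric_pos[OF that] .
  qed (rule cochains_zero)
qed

lemma tuple_metric_map:
  assumes adj: "\<And>x y. x \<in> V \<Longrightarrow> y \<in> V \<Longrightarrow> g (D x) y = g x (D' y)"
    and "length xs = length ys" "set xs \<subseteq> V" "set ys \<subseteq> V"
  shows "prod_list (map2 g (map D xs) ys) = prod_list (map2 g (map D' ys) xs)"
  using assms(2-)
proof (induction xs ys rule: list_induct2)
  case (Cons x xs y ys)
  then show ?case using adj[of x y] metric_commute[OF g, of x "D' y"] by simp
qed simp

text \<open>
  The coefficient of \<open>\<phi> ys\<close> in the expansion of \<open>\<phi> (map D xs)\<close> is a product of the entries
  \<open>g (D x) y = g x (D' y)\<close>, which is also the coefficient of \<open>\<psi> xs\<close> in the expansion of
  \<open>\<psi> (map D' ys)\<close>.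
\<close>

lemma cochain_metric_transport:
  assumes D: "\<And>x. x \<in> V \<Longrightarrow> D x \<in> V" "\<And>x. x \<in> V \<Longrightarrow> D' x \<in> V"
    and C: "linear C" "linear C'"
    and adjC: "\<And>x y. g (C x) y = g x (C' y)"
    and adjD: "\<And>x y. x \<in> V \<Longrightarrow> y \<in> V \<Longrightarrow> g (D x) y = g x (D' y)"
    and \<phi>: "multilinear_on V k \<phi>" and \<psi>: "multilinear_on V k \<psi>"
  shows "cochain_metric g V k (transport V C D \<phi>) \<psi> = cochain_metric g V k \<phi> (transport V C' D' \<psi>)"
proof -
  obtain E where E: "orthonormal_basis g V E" and
    metric: "\<And>k \<phi> \<psi>. cochain_metric g V k \<phi> \<psi> = (\<Sum>xs\<in>tuples E k. g (\<phi> xs) (\<psi> xs)) / fact k"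
    by (rule cochain_metric_eq) (rule that)
  have EV: "set xs \<subseteq> V" "length xs = k" if "xs \<in> tuples E k" for xs
    using E that by (auto simp: orthonormal_basis_def tuples_def)
  have map_V: "map f xs \<in> tuples V k" if "xs \<in> tuples E k" "\<And>x. x \<in> V \<Longrightarrow> f x \<in> V" for f xs
    using EV[OF that(1)] that(2) by (auto simp: tuples_def)
  have lin: "g (\<Sum>ys\<in>S. c ys *\<^sub>R x ys) z = (\<Sum>ys\<in>S. c ys * g (x ys) z)"
    "g z (\<Sum>ys\<in>S. c ys *\<^sub>R x ys) = (\<Sum>ys\<in>S. c ys * g z (x ys))" for S and c :: "_ \<Rightarrow> real" and x z
    by (simp_all add: linear_sum[OF metric_linear_left[OF g]] linear_scale[OF metric_linear_left[OF g]]
        linear_sum[OF metric_linear_right[OF g]] linear_scale[OF metric_linear_right[OF g]])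
  have "(\<Sum>xs\<in>tuples E k. g (transport V C D \<phi> xs) (\<psi> xs)) =
      (\<Sum>xs\<in>tuples E k. g (\<phi> (map D xs)) (C' (\<psi> xs)))"
    using EV by (intro sum.cong refl) (simp add: transport_def adjC)
  also have "\<dots> = (\<Sum>xs\<in>tuples E k. \<Sum>ys\<in>tuples E k.
      prod_list (map2 g (map D xs) ys) * g (\<phi> ys) (C' (\<psi> xs)))"
    using map_V D(1)
    by (intro sum.cong refl, subst multilinear_expansion[OF g E V \<phi>]) (simp_all add: lin)
  also have "\<dots> = (\<Sum>ys\<in>tuples E k. \<Sum>xs\<in>tuples E k.
      prod_list (map2 g (map D xs) ys) * g (\<phi> ys) (C' (\<psi> xs)))"
    by (rule sum.swap)
  also have "\<dots> = (\<Sum>ys\<in>tuples E k. \<Sum>xs\<in>tuples E k.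
      prod_list (map2 g (map D' ys) xs) * g (\<phi> ys) (C' (\<psi> xs)))"
    using EV by (intro sum.cong refl) (simp add: tuple_metric_map[OF adjD])
  also have "\<dots> = (\<Sum>ys\<in>tuples E k. g (\<phi> ys) (C' (\<psi> (map D' ys))))"
    using map_V D(2)
    by (intro sum.cong refl, subst multilinear_expansion[OF g E V multilinear_on_linear_comp[OF C(2) \<psi>]])
      (simp_all add: lin)
  also have "\<dots> = (\<Sum>ys\<in>tuples E k. g (\<phi> ys) (transport V C' D' \<psi> ys))"
    using EV by (intro sum.cong refl) (simp add: transport_def)
  finally show ?thesis by (simp add: metric)
qed

end

context
  fixes br :: "'h::euclidean_space \<Rightarrow> 'h \<Rightarrow> 'h" and g :: "'h \<Rightarrow> 'h \<Rightarrow> real"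
    and V :: "'h set"
  assumes br: "lie_algebra br" and V: "lie_subalgebra br V" and g: "euclidean_metric g"
begin

lemma codifferential_unique:
  assumes "\<psi> \<in> cochains V k"
    and "\<And>\<eta>. \<eta> \<in> cochains V k \<Longrightarrow>
      cochain_metric g V (Suc k) (coboundary br V k \<eta>) \<phi> = cochain_metric g V k \<eta> \<psi>"
  shows "codifferential br g V k \<phi> = \<psi>"
  unfolding codifferential_def
proof (rule the_equality)
  fix \<psi>'
  assume *: "\<psi>' \<in> cochains V k \<and> (\<forall>\<eta>\<in>cochains V k.
    cochain_metric g V (Suc k) (coboundary br V k \<eta>) \<phi> = cochain_metric g V k \<eta> \<psi>')"
  then show "\<psi>' = \<psi>"
    using assms cochain_metric_eqI[OF g lie_subalgebra_subspace[OF br V], of \<psi>' k \<psi>] by simp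
qed (use assms in simp)

lemma codifferential_adjoint:
  "codifferential br g V k \<phi> \<in> cochains V k \<and> (\<forall>\<eta>\<in>cochains V k.
     cochain_metric g V (Suc k) (coboundary br V k \<eta>) \<phi> =
     cochain_metric g V k \<eta> (codifferential br g V k \<phi>))"
proof -
  have "\<exists>\<psi>\<in>cochains V k. \<forall>\<eta>\<in>cochains V k.
      cochain_metric g V (Suc k) (coboundary br V k \<eta>) \<phi> = cochain_metric g V k \<eta> \<psi>"
  proof (rule cochain_functional_represented[OF g lie_subalgebra_subspace[OF br V]])
    fix \<eta> \<rho> and a b :: real
    have "coboundary br V k (\<lambda>xs. a *\<^sub>R \<eta> xs + b *\<^sub>R \<rho> xs) =
        (\<lambda>xs. a *\<^sub>R coboundary br V k \<eta> xs + b *\<^sub>R coboundary br V k \<rho> xs)"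
      by (rule ext) (rule coboundary_lincomb[OF br V])
    then show "cochain_metric g V (Suc k) (coboundary br V k (\<lambda>xs. a *\<^sub>R \<eta> xs + b *\<^sub>R \<rho> xs)) \<phi> =
        a * cochain_metric g V (Suc k) (coboundary br V k \<eta>) \<phi> +
        b * cochain_metric g V (Suc k) (coboundary br V k \<rho>) \<phi>"
      by (simp add: cochain_metric_lincomb[OF g lie_subalgebra_subspace[OF br V]])
  qed
  then obtain \<psi> where "\<psi> \<in> cochains V k" "\<And>\<eta>. \<eta> \<in> cochains V k \<Longrightarrow>
      cochain_metric g V (Suc k) (coboundary br V k \<eta>) \<phi> = cochain_metric g V k \<eta> \<psi>" by blast
  with codifferential_unique[OF this] show ?thesis by simp
qed

text \<open>
  The map \<open>transport V C D\<close> commutes with the codifferential because its adjoint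
  \<open>transport V C' D'\<close> commutes with the coboundary.
\<close>

lemma codifferential_transport:
  assumes C: "linear C" "linear C'" and adjC: "\<And>x y. g (C x) y = g x (C' y)"
    and D: "linear D" "\<And>x. x \<in> V \<Longrightarrow> D x \<in> V" "linear D'" "\<And>x. x \<in> V \<Longrightarrow> D' x \<in> V"
    and adjD: "\<And>x y. x \<in> V \<Longrightarrow> y \<in> V \<Longrightarrow> g (D x) y = g x (D' y)"
    and homC': "\<And>x y. C' (br x y) = br (C' x) (C' y)"
    and homD': "\<And>x y. D' (br x y) = br (D' x) (D' y)"
    and inv: "\<And>x. C' (D' x) = x"
    and \<phi>: "\<phi> \<in> cochains V (Suc k)"
  shows "codifferential br g V k (transport V C D \<phi>) = transport V C D (codifferential br g V k \<phi>)"
proof (rule codifferential_unique)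
  note sub = lie_subalgebra_subspace[OF br V]
  define \<psi> where "\<psi> = codifferential br g V k \<phi>"
  have \<psi>: "\<psi> \<in> cochains V k"
    "\<And>\<eta>. \<eta> \<in> cochains V k \<Longrightarrow>
      cochain_metric g V (Suc k) (coboundary br V k \<eta>) \<phi> = cochain_metric g V k \<eta> \<psi>"
    using codifferential_adjoint[of k \<phi>] by (simp_all add: \<psi>_def)
  show "transport V C D (codifferential br g V k \<phi>) \<in> cochains V k"
    using transport_cochain[OF br V C(1) D(1,2) \<psi>(1)] by (simp add: \<psi>_def)
  have adj: "cochain_metric g V j (transport V C D \<alpha>) \<beta> = cochain_metric g V j \<alpha> (transport V C' D' \<beta>)"
    if "multilinear_on V j \<alpha>" "multilinear_on V j \<beta>" for j \<alpha> \<beta>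
    using that by (intro cochain_metric_transport[OF g sub D(2,4) C adjC adjD])
  fix \<eta> assume \<eta>: "\<eta> \<in> cochains V k"
  have "cochain_metric g V (Suc k) (coboundary br V k \<eta>) (transport V C D \<phi>) =
      cochain_metric g V (Suc k) \<phi> (transport V C' D' (coboundary br V k \<eta>))"
    using adj[OF multilinear_on_cochain[OF \<phi>]
        multilinear_on_coboundary[OF br V multilinear_on_cochain[OF \<eta>]]]
    by (simp add: cochain_metric_commute[OF g sub])
  also have "\<dots> = cochain_metric g V (Suc k) (coboundary br V k (transport V C' D' \<eta>)) \<phi>"
    by (simp add: cochain_metric_commute[OF g sub, of _ \<phi>]
        coboundary_transport[OF br V C(2) homC' D(4) homD' inv])
  also have "\<dots> = cochain_metric g V k (transport V C' D' \<eta>) \<psi>"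
    by (intro \<psi>(2) transport_cochain[OF br V C(2) D(3,4) \<eta>])
  also have "\<dots> = cochain_metric g V k \<eta> (transport V C D \<psi>)"
    using adj[OF multilinear_on_cochain[OF \<psi>(1)] multilinear_on_cochain[OF \<eta>]]
    by (simp add: cochain_metric_commute[OF g sub])
  finally show "cochain_metric g V (Suc k) (coboundary br V k \<eta>) (transport V C D \<phi>) =
      cochain_metric g V k \<eta> (transport V C D (codifferential br g V k \<phi>))"
    by (simp add: \<psi>_def)
qed

end

section \<open>The Killing form\<close>

lemma lin_trace_comp_commute:
  fixes f h :: "'a::euclidean_space \<Rightarrow> 'a"
  assumes "linear f" "linear h"
  shows "lin_trace (f \<circ> h) = lin_trace (h \<circ> f)"
proof -
  have expand: "lin_trace (u \<circ> v) = (\<Sum>b\<in>Basis. \<Sum>c\<in>Basis. (v b \<bullet> c) * (u c \<bullet> b))"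
    if "linear u" for u v :: "'a \<Rightarrow> 'a"
  proof -
    have "u (v b) \<bullet> b = (\<Sum>c\<in>Basis. (v b \<bullet> c) * (u c \<bullet> b))" for b
    proof -
      have "u (v b) = u (\<Sum>c\<in>Basis. (v b \<bullet> c) *\<^sub>R c)" by (simp add: euclidean_representation)
      also have "\<dots> = (\<Sum>c\<in>Basis. (v b \<bullet> c) *\<^sub>R u c)"
        by (simp add: linear_sum[OF that] linear_scale[OF that])
      finally show ?thesis by (simp add: inner_sum_left)
    qed
    then show ?thesis by (simp add: lin_trace_def)
  qed
  have "lin_trace (f \<circ> h) = (\<Sum>b\<in>Basis. \<Sum>c\<in>Basis. (f c \<bullet> b) * (h b \<bullet> c))"
    using expand[OF assms(1), of h] by (simp add: mult.commute)
  also have "\<dots> = lin_trace (h \<circ> f)"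
    using expand[OF assms(2), of f] by (subst sum.swap) simp
  finally show ?thesis .
qed

lemma lin_trace_lincomb:
  "lin_trace (\<lambda>x. a *\<^sub>R f x + b *\<^sub>R h x) = a * lin_trace f + b * lin_trace h"
  by (simp add: lin_trace_def inner_add_left sum.distrib sum_distrib_left)

lemma lin_trace_sum: "lin_trace (\<lambda>x. \<Sum>i\<in>S. f i x) = (\<Sum>i\<in>S. lin_trace (f i))"
  unfolding lin_trace_def inner_sum_left by (rule sum.swap)

context
  fixes br :: "'h::euclidean_space \<Rightarrow> 'h \<Rightarrow> 'h"
  assumes br: "lie_algebra br"
begin

lemma killing_commute: "killing br X Y = killing br Y X"
  unfolding killing_def by (rule lin_trace_comp_commute[OF linear_ad[OF br] linear_ad[OF br]])

lemma linear_killing: "linear (killing br X)"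
proof (rule linearI)
  have eq: "killing br X (a *\<^sub>R Y + b *\<^sub>R Z) = a * killing br X Y + b * killing br X Z" for a b Y Z
  proof -
    have "br X \<circ> br (a *\<^sub>R Y + b *\<^sub>R Z) = (\<lambda>x. a *\<^sub>R (br X \<circ> br Y) x + b *\<^sub>R (br X \<circ> br Z) x)"
      using linear_add[OF linear_ad_left[OF br]] linear_scale[OF linear_ad_left[OF br]]
      by (simp add: fun_eq_iff linear_add[OF linear_ad[OF br]] linear_scale[OF linear_ad[OF br]])
    then show ?thesis unfolding killing_def by (simp only: lin_trace_lincomb)
  qed
  show "killing br X (Y + Z) = killing br X Y + killing br X Z" for Y Z
    using eq[of 1 Y 1 Z] by simp
  show "killing br X (c *\<^sub>R Y) = c *\<^sub>R killing br X Y" for c Y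
    using eq[of c Y 0 0] by simp
qed

text \<open>
  An automorphism conjugates \<open>ad X \<circ> ad Y\<close> into \<open>ad (A X) \<circ> ad (A Y)\<close>, and conjugate maps have the
  same trace.
\<close>

lemma killing_automorphism:
  assumes A: "linear A" "linear B" "\<And>x. A (B x) = x" "\<And>x. B (A x) = x"
    and hom: "\<And>x y. A (br x y) = br (A x) (A y)"
  shows "killing br (A X) (A Y) = killing br X Y"
proof -
  have "br (A X) z = A (br X (B z))" for X z using hom[of X "B z"] A(3)[of z] by simp
  then have "br (A X) \<circ> br (A Y) = A \<circ> (br X \<circ> br Y \<circ> B)"
    using A(4) by (simp add: fun_eq_iff)
  moreover have "linear (br X \<circ> br Y \<circ> B)"
    by (intro linear_compose linear_ad[OF br] A(2))
  ultimately have "killing br (A X) (A Y) = lin_trace ((br X \<circ> br Y \<circ> B) \<circ> A)"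
    unfolding killing_def by (simp only: lin_trace_comp_commute[OF A(1)])
  also have "(br X \<circ> br Y \<circ> B) \<circ> A = br X \<circ> br Y" using A(4) by (simp add: fun_eq_iff)
  finally show ?thesis unfolding killing_def .
qed

text \<open>
  Symmetry is the invariance of the Killing form under the automorphism \<open>\<theta>\<close>; positivity is the
  definition of a Cartan involution.
\<close>

lemma killing_metric_euclidean:
  assumes "cartan_involution br \<theta>"
  shows "euclidean_metric (killing_metric br \<theta>)"
proof -
  have \<theta>: "linear \<theta>" "\<And>x y. \<theta> (br x y) = br (\<theta> x) (\<theta> y)" "\<And>x. \<theta> (\<theta> x) = x"
    "\<And>x. x \<noteq> 0 \<Longrightarrow> killing_metric br \<theta> x x > 0"
    using assms by (auto simp: cartan_involution_def)
  have "killing br X (\<theta> Y) = killing br Y (\<theta> X)" for X Y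
    using killing_automorphism[OF \<theta>(1) \<theta>(1) \<theta>(3) \<theta>(3) \<theta>(2), of X "\<theta> Y"] \<theta>(3)[of Y]
      killing_commute[of Y "\<theta> X"] by simp
  then have comm: "killing_metric br \<theta> X Y = killing_metric br \<theta> Y X" for X Y
    by (simp add: killing_metric_def)
  have lin: "linear (killing_metric br \<theta> X)" for X
    unfolding killing_metric_def
    by (rule linearI)
      (simp_all add: linear_add[OF \<theta>(1)] linear_scale[OF \<theta>(1)] linear_add[OF linear_killing]
        linear_scale[OF linear_killing])
  have "linear (\<lambda>X. killing_metric br \<theta> X Y)" for Y
    using lin[of Y] by (simp add: comm[of _ Y])
  with lin comm \<theta>(4) show ?thesis unfolding euclidean_metric_def by blast
qed

end

section \<open>Gradations\<close>

context
  fixes br :: "'h::euclidean_space \<Rightarrow> 'h \<Rightarrow> 'h" and l :: nat and hh :: "int \<Rightarrow> 'h set"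
  assumes graded: "graded_by br l hh"
begin

text \<open>
  The homogeneous component of degree \<open>i\<close>. It is zero for \<open>\<bar>i\<bar> > l\<close>, since the components of the
  gradation are zero there.
\<close>

definition component :: "'h \<Rightarrow> int \<Rightarrow> 'h" where
  "component x = (THE f. (\<forall>i. f i \<in> hh i) \<and> x = (\<Sum>i\<in>{- int l..int l}. f i))"

lemma subspace_degree: "subspace (hh i)"
  using graded by (simp add: graded_by_def)

lemma component_props: "component x i \<in> hh i" "(\<Sum>i\<in>{- int l..int l}. component x i) = x"
proof -
  have "\<exists>!f. (\<forall>i. f i \<in> hh i) \<and> x = (\<Sum>i\<in>{- int l..int l}. f i)"
    using graded unfolding graded_by_def by blast
  from theI'[OF this] show "component x i \<in> hh i" "(\<Sum>i\<in>{- int l..int l}. component x i) = x"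
    unfolding component_def by auto
qed

lemma component_eqI:
  assumes "\<And>i. f i \<in> hh i" "x = (\<Sum>i\<in>{- int l..int l}. f i)"
  shows "component x = f"
proof -
  have "\<exists>!f. (\<forall>i. f i \<in> hh i) \<and> x = (\<Sum>i\<in>{- int l..int l}. f i)"
    using graded unfolding graded_by_def by blast
  from the1_equality[OF this] show ?thesis
    using assms unfolding component_def by blast
qed

lemma linear_component: "linear (\<lambda>x. component x i)"
proof (rule linearI)
  have "component (x + y) = (\<lambda>i. component x i + component y i)" for x y
    by (rule component_eqI)
      (simp_all add: component_props subspace_add[OF subspace_degree] sum.distrib)
  then show "component (x + y) i = component x i + component y i" for x y by simp
  have "component (c *\<^sub>R x) = (\<lambda>i. c *\<^sub>R component x i)" for c x
    by (rule component_eqI)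
      (simp_all add: component_props subspace_scale[OF subspace_degree] flip: scaleR_sum_right)
  then show "component (c *\<^sub>R x) i = c *\<^sub>R component x i" for c x by simp
qed

lemma component_homogeneous:
  assumes "x \<in> hh m"
  shows "component x i = (if i = m then x else 0)"
proof -
  have "component x = (\<lambda>i. if i = m then x else 0)"
  proof (rule component_eqI)
    show "(if i = m then x else 0) \<in> hh i" for i
      using assms subspace_0[OF subspace_degree] by simp
    show "x = (\<Sum>i = - int l..int l. if i = m then x else 0)"
    proof (cases "\<bar>m\<bar> > int l")
      case True
      then have "x = 0" using assms graded by (auto simp: graded_by_def)
      then show ?thesis by simp
    next
      case False
      then have "m \<in> {- int l..int l}" by auto
      then show ?thesis by simp
    qed
  qed
  then show ?thesis by simp
qed

text \<open>
  With \<open>P\<close> the projection to one degree, cyclicity gives \<open>tr (P \<circ> T) = tr (P \<circ> T \<circ> P)\<close>, and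
  \<open>P \<circ> T \<circ> P = 0\<close> because \<open>T\<close> leaves the degree. The projections sum to the identity.
\<close>

lemma lin_trace_shift:
  assumes T: "linear T" "\<And>m x. x \<in> hh m \<Longrightarrow> T x \<in> hh (m + d)" and "d \<noteq> 0"
  shows "lin_trace T = 0"
proof -
  have "lin_trace T = (\<Sum>i\<in>{- int l..int l}. lin_trace (\<lambda>x. component (T x) i))"
    by (simp add: component_props flip: lin_trace_sum)
  also have "\<dots> = 0"
  proof (rule sum.neutral, rule ballI)
    fix i
    let ?P = "\<lambda>x. component x i"
    have "?P \<circ> (?P \<circ> T) = (\<lambda>x. component (T x) i)"
      using component_homogeneous[OF component_props(1)] by (simp add: fun_eq_iff)
    then have "lin_trace (\<lambda>x. component (T x) i) = lin_trace ((?P \<circ> T) \<circ> ?P)"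
      using lin_trace_comp_commute[OF linear_component linear_compose[OF T(1) linear_component]]
      by metis
    also have "(?P \<circ> T) \<circ> ?P = (\<lambda>x. 0)"
      using component_homogeneous[OF T(2)[OF component_props(1)], of _ _ i] \<open>d \<noteq> 0\<close>
      by (simp add: fun_eq_iff)
    finally show "lin_trace (\<lambda>x. component (T x) i) = 0" by (simp add: lin_trace_def)
  qed
  finally show ?thesis .
qed

lemma killing_homogeneous:
  assumes "lie_algebra br" "x \<in> hh i" "y \<in> hh j" "i + j \<noteq> 0"
  shows "killing br x y = 0"
  unfolding killing_def
proof (rule lin_trace_shift[OF _ _ assms(4)])
  show "linear (br x \<circ> br y)" by (intro linear_compose linear_ad assms(1))
  have bracket: "br u v \<in> hh (p + q)" if "u \<in> hh p" "v \<in> hh q" for u v p q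
    using graded that by (simp add: graded_by_def)
  show "(br x \<circ> br y) z \<in> hh (m + (i + j))" if "z \<in> hh m" for z m
    using bracket[OF assms(2) bracket[OF assms(3) that]] by (simp add: ac_simps)
qed

lemma neg_plus_nonneg: "\<exists>y\<in>neg_part hh. x - y \<in> nonneg_part hh"
proof
  show "(\<Sum>i\<in>{- int l..<0}. component x i) \<in> neg_part hh"
    unfolding neg_part_def by (intro span_sum span_base) (use component_props(1) in auto)
  have "(\<Sum>i\<in>{- int l..int l}. component x i) =
      (\<Sum>i\<in>{- int l..<0}. component x i) + (\<Sum>i\<in>{0..int l}. component x i)"
    by (subst sum.union_disjoint[symmetric]) (auto intro!: sum.cong)
  then have "x - (\<Sum>i\<in>{- int l..<0}. component x i) = (\<Sum>i\<in>{0..int l}. component x i)"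
    using component_props(2)[of x] by (metis add_diff_cancel_left')
  also have "\<dots> \<in> nonneg_part hh"
    unfolding nonneg_part_def by (intro span_sum span_base) (use component_props(1) in auto)
  finally show "x - (\<Sum>i\<in>{- int l..<0}. component x i) \<in> nonneg_part hh" .
qed

end

text \<open>
  As the gradation is fundamental, this makes the negative part a subalgebra.
\<close>

lemma lie_subalgebra_lie_generated: "lie_subalgebra br (lie_generated br S)"
  unfolding lie_generated_def lie_subalgebra_def
  by (auto intro!: subspace_Inter)

lemma neg_nonneg_orthogonal:
  assumes g: "euclidean_metric g" and adapted: "adapted_metric hh g"
    and x: "x \<in> neg_part hh" and y: "y \<in> nonneg_part hh"
  shows "g x y = 0"
proof -
  have base: "g u v = 0" if "u \<in> hh i" "i < 0" "v \<in> hh j" "j \<ge> 0" for u v i j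
    using adapted that unfolding adapted_metric_def by (metis not_less)
  have "g u y = 0" if "u \<in> hh i" "i < 0" for u i
    using y unfolding nonneg_part_def
  proof (induction rule: span_induct_alt)
    case (step c v w)
    then show ?case
      using base[OF that] linear_add[OF metric_linear_right[OF g]]
        linear_scale[OF metric_linear_right[OF g]] by auto
  qed (use linear_0[OF metric_linear_right[OF g]] in simp)
  note * = this
  show ?thesis using x unfolding neg_part_def
  proof (induction rule: span_induct_alt)
    case (step c v w)
    then show ?case
      using * linear_add[OF metric_linear_left[OF g]]
        linear_scale[OF metric_linear_left[OF g]] by auto
  qed (use metric_0_left[OF g] in simp)
qed

context
  fixes br :: "'h::euclidean_space \<Rightarrow> 'h \<Rightarrow> 'h" and l :: nat and hh :: "int \<Rightarrow> 'h set" and \<theta>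
  assumes br: "lie_algebra br" and grad: "fundamental_gradation br l hh"
    and cartan: "cartan_involution br \<theta>" and \<theta>_hh: "\<And>i. \<theta> ` hh i = hh (- i)"
begin

lemma killing_metric_adapted: "adapted_metric hh (killing_metric br \<theta>)"
  unfolding adapted_metric_def killing_metric_def
proof (intro allI impI ballI)
  fix i j :: int and x y
  assume ij: "i \<noteq> j" and x: "x \<in> hh i" and "y \<in> hh j"
  then have "\<theta> y \<in> hh (- j)" using \<theta>_hh[of j] by blast
  then have "killing br x (\<theta> y) = 0"
    using grad ij x
    by (intro killing_homogeneous[where l = l and hh = hh and i = i and j = "- j"] br)
      (simp_all add: fundamental_gradation_def)
  then show "- killing br x (\<theta> y) = 0" by simp
qed

text \<open>
  The automorphism \<open>A\<close> stands for \<open>Ad a\<close>, and \<open>B\<close> is its inverse. The adjoint of \<open>A\<close> is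
  \<open>C' = \<theta> \<circ> B \<circ> \<theta>\<close>, the adjoint of \<open>B\<close> is \<open>D' = \<theta> \<circ> A \<circ> \<theta>\<close>, and on the negative part \<open>D'\<close> is also the
  adjoint of the compression \<open>D\<close> of \<open>B\<close>.
\<close>

lemma codifferential_automorphism:
  assumes A: "linear A" "linear B" "\<And>x. A (B x) = x" "\<And>x. B (A x) = x"
    and hom: "\<And>x y. A (br x y) = br (A x) (A y)"
    and q: "\<And>x. x \<in> nonneg_part hh \<Longrightarrow> B x \<in> nonneg_part hh"
    and \<phi>: "\<phi> \<in> cochains (neg_part hh) (Suc k)"
  defines "\<g> \<equiv> killing_metric br \<theta>" and "V \<equiv> neg_part hh" and "D \<equiv> induced_on_neg hh B"
  shows "codifferential br \<g> V k (transport V A D \<phi>) = transport V A D (codifferential br \<g> V k \<phi>)"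
proof -
  have \<theta>: "linear \<theta>" "\<And>x y. \<theta> (br x y) = br (\<theta> x) (\<theta> y)" "\<And>x. \<theta> (\<theta> x) = x"
    using cartan by (auto simp: cartan_involution_def)
  have graded: "graded_by br l hh" using grad by (simp add: fundamental_gradation_def)
  have g: "euclidean_metric \<g>" unfolding \<g>_def by (rule killing_metric_euclidean[OF br cartan])
  have perp: "\<g> x y = 0" "\<g> y x = 0" if "x \<in> V" "y \<in> nonneg_part hh" for x y
    using neg_nonneg_orthogonal[OF g killing_metric_adapted[folded \<g>_def], of x y] that
      metric_commute[OF g, of y x] by (simp_all add: V_def)
  have sub: "subspace V" "subspace (nonneg_part hh)"
    by (simp_all add: V_def neg_part_def nonneg_part_def)
  have V: "lie_subalgebra br V"
    using lie_subalgebra_lie_generated[of br "hh (-1)"] grad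
    by (simp add: fundamental_gradation_def V_def)
  have D_eq: "D x = y" if "y \<in> V" "B x - y \<in> nonneg_part hh" for x y
    unfolding D_def induced_on_neg_def
  proof (rule the_equality)
    fix z assume z: "z \<in> neg_part hh \<and> B x - z \<in> nonneg_part hh"
    then have "z - y \<in> V" "(B x - y) - (B x - z) \<in> nonneg_part hh"
      using that sub unfolding V_def by (blast intro: subspace_diff)+
    then have "\<g> (z - y) (z - y) = 0" by (intro perp) simp_all
    then show "z = y" using metric_pos[OF g, of "z - y"] by fastforce
  qed (use that in \<open>simp add: V_def\<close>)
  have D: "D x \<in> V" "B x - D x \<in> nonneg_part hh" for x
  proof -
    obtain y where "y \<in> V" "B x - y \<in> nonneg_part hh"
      using neg_plus_nonneg[OF graded, of "B x"] V_def by blast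
    with D_eq[OF this] show "D x \<in> V" "B x - D x \<in> nonneg_part hh" by simp_all
  qed
  have lin_D: "linear D"
  proof (rule linearI)
    fix x y :: 'h and c :: real
    have "B (x + y) - (D x + D y) = (B x - D x) + (B y - D y)"
      by (simp add: linear_add[OF A(2)])
    also have "\<dots> \<in> nonneg_part hh" by (intro subspace_add sub D)
    finally show "D (x + y) = D x + D y" by (intro D_eq subspace_add sub D)
    have "B (c *\<^sub>R x) - c *\<^sub>R D x = c *\<^sub>R (B x - D x)"
      by (simp add: linear_scale[OF A(2)] scaleR_right_diff_distrib)
    also have "\<dots> \<in> nonneg_part hh" by (intro subspace_scale sub D)
    finally show "D (c *\<^sub>R x) = c *\<^sub>R D x" by (intro D_eq subspace_scale sub D)
  qed
  have homB: "B (br x y) = br (B x) (B y)" for x y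
    using arg_cong[OF hom[of "B x" "B y"], of B] by (simp only: A(3,4))
  \<comment> \<open>Stated for any automorphism, so that it applies to \<open>A\<close> and to \<open>B\<close>.\<close>
  have adj: "\<g> (A' x) y = \<g> x (\<theta> (B' (\<theta> y)))"
    if "linear A'" "linear B'" "\<And>x. A' (B' x) = x" "\<And>x. B' (A' x) = x"
      "\<And>x y. A' (br x y) = br (A' x) (A' y)" for A' B' x y
  proof -
    have "killing br (A' x) (A' (B' (\<theta> y))) = killing br x (B' (\<theta> y))"
      by (rule killing_automorphism[OF br]) (fact that)+
    then show ?thesis by (simp only: \<g>_def killing_metric_def that(3) \<theta>(3))
  qed
  define C' where "C' = (\<lambda>x. \<theta> (B (\<theta> x)))"
  define D' where "D' = (\<lambda>x. \<theta> (A (\<theta> x)))"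
  have lin: "linear C'" "linear D'"
    using linear_compose[OF linear_compose[OF \<theta>(1) A(2)] \<theta>(1)]
      linear_compose[OF linear_compose[OF \<theta>(1) A(1)] \<theta>(1)]
    by (simp_all add: C'_def D'_def o_def)
  \<comment> \<open>\<open>D' y\<close> is orthogonal to the nonnegative part, because \<open>B\<close> preserves that part; so it equals its
    own negative component \<open>w\<close>.\<close>
  have D'_V: "D' y \<in> V" if y: "y \<in> V" for y
  proof -
    have "\<g> z (D' y) = 0" if "z \<in> nonneg_part hh" for z
      using adj[OF A(2,1,4,3) homB, of z y] perp(2)[OF y q[OF that]] by (simp add: D'_def)
    moreover obtain w where w: "w \<in> V" "D' y - w \<in> nonneg_part hh"
      using neg_plus_nonneg[OF graded, of "D' y"] V_def by blast
    ultimately have "\<g> (D' y - w) (D' y) = 0" "\<g> (D' y - w) w = 0"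
      using perp(2)[OF w] by blast+
    then have "\<g> (D' y - w) (D' y - w) = 0"
      by (simp add: linear_diff[OF metric_linear_right[OF g]])
    then have "D' y = w" using metric_pos[OF g, of "D' y - w"] by fastforce
    with w(1) show ?thesis by simp
  qed
  have "\<g> (D x) y = \<g> x (D' y)" if "y \<in> V" for x y
  proof -
    have "\<g> (B x - D x) y = 0" using perp(2)[OF that D(2)] .
    then have "\<g> (D x) y = \<g> (B x) y" by (simp add: linear_diff[OF metric_linear_left[OF g]])
    then show ?thesis using adj[OF A(2,1,4,3) homB, of x y] by (simp add: D'_def)
  qed
  then show ?thesis
    using adj[OF A hom] \<phi> lin D(1) lin_D D'_V A \<theta> homB hom
    by (intro codifferential_transport[OF br V g, where C' = C' and D' = D'])
      (simp_all add: C'_def D'_def V_def)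
qed

end

section \<open>Differentiability in charts\<close>

lemma has_derivative_eventually_cong:
  assumes "(f has_derivative f') (at x)" "\<forall>\<^sub>F y in nhds x. f y = h y"
  shows "(h has_derivative f') (at x)"
proof -
  obtain S where S: "open S" "x \<in> S" "\<And>y. y \<in> S \<Longrightarrow> f y = h y"
    using assms(2) unfolding eventually_nhds by blast
  show ?thesis by (rule has_derivative_transform_within_open[OF assms(1) S])
qed

lemma smooth_on_differentiable:
  assumes "smooth_on S f" "x \<in> S"
  shows "f differentiable (at x)" "(\<lambda>x. frechet_derivative f (at x) v) differentiable (at x)"
proof -
  have "Ck_on (Suc (Suc 0)) S f" using assms(1) unfolding smooth_on_def by blast
  then show "f differentiable (at x)" "(\<lambda>x. frechet_derivative f (at x) v) differentiable (at x)"
    using assms(2) unfolding Ck_on.simps by blast+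
qed

context
  fixes T :: "'g topology" and A :: "('g, 'm::euclidean_space) chart set"
  assumes mfd: "smooth_manifold T A"
begin

lemma chart_openin: "(U, \<phi>) \<in> A \<Longrightarrow> openin T U"
  and chart_homeomorphic: "(U, \<phi>) \<in> A \<Longrightarrow> homeomorphic_map (subtopology T U) (top_of_set (\<phi> ` U)) \<phi>"
  and chart_open_image: "(U, \<phi>) \<in> A \<Longrightarrow> open (\<phi> ` U)"
  using mfd by (auto simp: smooth_manifold_def is_chart_def)

lemma chart_subset: "(U, \<phi>) \<in> A \<Longrightarrow> U \<subseteq> topspace T"
  using chart_openin openin_subset by blast

lemma chart_inj:
  assumes "(U, \<phi>) \<in> A" shows "inj_on \<phi> U"
  using homeomorphic_imp_injective_map[OF chart_homeomorphic[OF assms]] chart_subset[OF assms]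
  by (simp add: Int_absorb1)

lemma chart_cover: "p \<in> topspace T \<Longrightarrow> \<exists>U \<phi>. (U, \<phi>) \<in> A \<and> p \<in> U"
  using mfd unfolding smooth_manifold_def by blast

lemma chart_inv_into: "(U, \<phi>) \<in> A \<Longrightarrow> p \<in> U \<Longrightarrow> inv_into U \<phi> (\<phi> p) = p"
  by (simp add: inv_into_f_f[OF chart_inj])

lemma chart_open_image_Int:
  assumes c: "(U, \<phi>) \<in> A" and W: "openin T W"
  shows "open (\<phi> ` (U \<inter> W))"
proof -
  have "openin (subtopology T U) (U \<inter> W)"
    using W by (auto simp: openin_subtopology)
  then have "openin (top_of_set (\<phi> ` U)) (\<phi> ` (U \<inter> W))"
    using homeomorphic_map_openness_eq[OF chart_homeomorphic[OF c]] by blast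
  then show ?thesis
    using chart_open_image[OF c] by (simp add: openin_open_eq)
qed

lemma eventually_chart:
  assumes c: "(U, \<phi>) \<in> A" and p: "p \<in> U" "p \<in> W" and W: "openin T W"
  shows "\<forall>\<^sub>F x in nhds (\<phi> p). x \<in> \<phi> ` U \<and> inv_into U \<phi> x \<in> U \<and> inv_into U \<phi> x \<in> W"
  unfolding eventually_nhds
  by (rule exI[of _ "\<phi> ` (U \<inter> W)"])
    (use chart_open_image_Int[OF c W] p in \<open>auto simp: chart_inv_into[OF c]\<close>)

end

text \<open>
  The first clause replaces the continuity of \<open>f\<close>: it guarantees that the expression in charts is
  meaningful near the point, so that differentiability of the expression is a property of \<open>f\<close>.
\<close>

definition chart_differentiable ::
    "('g, 'm::real_normed_vector) chart set \<Rightarrow> ('k, 'n::real_normed_vector) chart set \<Rightarrow>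
      ('g \<Rightarrow> 'k) \<Rightarrow> 'g \<Rightarrow> bool" where
  "chart_differentiable A A' f p \<longleftrightarrow>
     (\<forall>U \<phi> V \<psi>. (U, \<phi>) \<in> A \<and> (V, \<psi>) \<in> A' \<and> p \<in> U \<and> f p \<in> V \<longrightarrow>
        (\<forall>\<^sub>F x in nhds (\<phi> p). f (inv_into U \<phi> x) \<in> V) \<and>
        (\<psi> \<circ> f \<circ> inv_into U \<phi>) differentiable (at (\<phi> p)))"

definition chart_deriv ::
    "('g, 'm::real_normed_vector) chart \<Rightarrow> ('k, 'n::real_normed_vector) chart \<Rightarrow>
      ('g \<Rightarrow> 'k) \<Rightarrow> 'g \<Rightarrow> 'm \<Rightarrow> 'n" where
  "chart_deriv c d f p = frechet_derivative (snd d \<circ> f \<circ> inv_into (fst c) (snd c)) (at (snd c p))"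

lemma chart_differentiableD:
  assumes "chart_differentiable A A' f p" "(U, \<phi>) \<in> A" "(V, \<psi>) \<in> A'" "p \<in> U" "f p \<in> V"
  shows "\<forall>\<^sub>F x in nhds (\<phi> p). f (inv_into U \<phi> x) \<in> V"
    and "(\<psi> \<circ> f \<circ> inv_into U \<phi> has_derivative chart_deriv (U, \<phi>) (V, \<psi>) f p) (at (\<phi> p))"
  using assms unfolding chart_differentiable_def chart_deriv_def
  by (auto simp: frechet_derivative_works)

lemma smooth_map_chart_differentiable:
  assumes "smooth_manifold T A" "smooth_manifold T' A'" "smooth_map T A T' A' f"
  shows "chart_differentiable A A' f p"
  unfolding chart_differentiable_def
proof (intro allI impI, elim conjE, intro conjI)
  fix U \<phi> V \<psi>
  assume c: "(U, \<phi>) \<in> A" "(V, \<psi>) \<in> A'" and p: "p \<in> U" "f p \<in> V"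
  have "openin T {x \<in> topspace T. f x \<in> V}"
    using assms(3) chart_openin[OF assms(2) c(2)]
    by (auto simp: smooth_map_def intro: openin_continuous_map_preimage)
  moreover have "p \<in> {x \<in> topspace T. f x \<in> V}"
    using p chart_subset[OF assms(1) c(1)] by blast
  ultimately have "\<forall>\<^sub>F x in nhds (\<phi> p). x \<in> \<phi> ` U \<and> inv_into U \<phi> x \<in> U \<and>
      inv_into U \<phi> x \<in> {x \<in> topspace T. f x \<in> V}"
    by (intro eventually_chart[OF assms(1) c(1) p(1)])
  then show "\<forall>\<^sub>F x in nhds (\<phi> p). f (inv_into U \<phi> x) \<in> V"
    by eventually_elim simp
  have "smooth_on (\<phi> ` {p \<in> U. f p \<in> V}) (\<psi> \<circ> f \<circ> inv_into U \<phi>)"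
    using assms(3) c unfolding smooth_map_def by blast
  then show "(\<psi> \<circ> f \<circ> inv_into U \<phi>) differentiable (at (\<phi> p))"
    by (rule smooth_on_differentiable(1)) (use p in simp)
qed

lemma chart_differentiable_id:
  assumes "smooth_manifold T A"
  shows "chart_differentiable A A (\<lambda>x. x) p"
  unfolding chart_differentiable_def
proof (intro allI impI, elim conjE, intro conjI)
  fix U \<phi> V \<psi>
  assume c: "(U, \<phi>) \<in> A" "(V, \<psi>) \<in> A" and p: "p \<in> U" "p \<in> V"
  show "\<forall>\<^sub>F x in nhds (\<phi> p). inv_into U \<phi> x \<in> V"
    using eventually_chart[OF assms c(1) p chart_openin[OF assms c(2)]]
    by eventually_elim simp
  have "\<forall>(U, \<phi>)\<in>A. \<forall>(V, \<psi>)\<in>A. smooth_on (\<phi> ` (U \<inter> V)) (\<psi> \<circ> inv_into U \<phi>)"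
    using assms by (simp add: smooth_manifold_def)
  from bspec[OF this c(1)] have "smooth_on (\<phi> ` (U \<inter> V)) (\<psi> \<circ> inv_into U \<phi>)"
    using c(2) by auto
  then have "(\<psi> \<circ> inv_into U \<phi>) differentiable (at (\<phi> p))"
    by (rule smooth_on_differentiable(1)) (use p in simp)
  then show "(\<psi> \<circ> (\<lambda>x. x) \<circ> inv_into U \<phi>) differentiable (at (\<phi> p))"
    by (simp add: comp_def)
qed

lemma chart_differentiable_const: "chart_differentiable A A' (\<lambda>x. q) p"
  by (auto simp: chart_differentiable_def comp_def)

lemma chart_differentiable_Pair:
  assumes "chart_differentiable A A' f p" "chart_differentiable A A'' h p"
  shows "chart_differentiable A (prod_atlas A' A'') (\<lambda>x. (f x, h x)) p"
  unfolding chart_differentiable_def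
proof (intro allI impI, elim conjE)
  fix U \<phi> Z \<psi>
  assume c: "(U, \<phi>) \<in> A" "p \<in> U" and "(Z, \<psi>) \<in> prod_atlas A' A''" and p: "(f p, h p) \<in> Z"
  then obtain V W \<alpha> \<beta> where Z: "Z = V \<times> W" "\<psi> = map_prod \<alpha> \<beta>" "(V, \<alpha>) \<in> A'" "(W, \<beta>) \<in> A''"
    by (auto simp: prod_atlas_def)
  note f = chart_differentiableD[OF assms(1) c(1) Z(3) c(2)]
  note h = chart_differentiableD[OF assms(2) c(1) Z(4) c(2)]
  have "(\<psi> \<circ> (\<lambda>x. (f x, h x)) \<circ> inv_into U \<phi>) =
      (\<lambda>x. ((\<alpha> \<circ> f \<circ> inv_into U \<phi>) x, (\<beta> \<circ> h \<circ> inv_into U \<phi>) x))"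
    by (simp add: Z(2) fun_eq_iff)
  then have "(\<psi> \<circ> (\<lambda>x. (f x, h x)) \<circ> inv_into U \<phi>) differentiable (at (\<phi> p))"
    using has_derivative_Pair[OF f(2) h(2)] p Z(1) by (auto simp: differentiable_def)
  with eventually_conj[OF f(1) h(1)] p Z(1)
  show "(\<forall>\<^sub>F x in nhds (\<phi> p). (f (inv_into U \<phi> x), h (inv_into U \<phi> x)) \<in> Z) \<and>
      (\<psi> \<circ> (\<lambda>x. (f x, h x)) \<circ> inv_into U \<phi>) differentiable (at (\<phi> p))"
    by simp
qed

text \<open>
  The chain rule in charts. What it takes from the intermediate atlas is the injectivity of the
  charts; in this form it applies directly to a product atlas.
\<close>

lemma chart_chain:
  assumes mfd: "smooth_manifold T A"
    and inj: "\<And>V \<psi>. (V, \<psi>) \<in> A' \<Longrightarrow> inj_on \<psi> V"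
    and f: "chart_differentiable A A' f p" and h: "chart_differentiable A' A'' h (f p)"
    and c: "(U, \<phi>) \<in> A" "p \<in> U" and d: "(V, \<psi>) \<in> A'" "f p \<in> V"
    and e: "(W, \<rho>) \<in> A''" "h (f p) \<in> W"
  shows "\<forall>\<^sub>F x in nhds (\<phi> p). h (f (inv_into U \<phi> x)) \<in> W"
    and "(\<rho> \<circ> (h \<circ> f) \<circ> inv_into U \<phi> has_derivative
      chart_deriv (V, \<psi>) (W, \<rho>) h (f p) \<circ> chart_deriv (U, \<phi>) (V, \<psi>) f p) (at (\<phi> p))"
proof -
  define u where "u = \<psi> \<circ> f \<circ> inv_into U \<phi>"
  note f' = chart_differentiableD[OF f c(1) d(1) c(2) d(2)]
  note h' = chart_differentiableD[OF h d(1) e(1) d(2) e(2)]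
  have up: "u (\<phi> p) = \<psi> (f p)" using chart_inv_into[OF mfd c] by (simp add: u_def)
  have inv_u: "\<forall>\<^sub>F x in nhds (\<phi> p). inv_into V \<psi> (u x) = f (inv_into U \<phi> x)"
    using f'(1) by eventually_elim (simp add: u_def inv_into_f_f[OF inj[OF d(1)]])
  have "isCont u (\<phi> p)"
    using f'(2) has_derivative_continuous u_def by blast
  then have "filterlim u (nhds (\<psi> (f p))) (nhds (\<phi> p))"
    unfolding up[symmetric] isCont_def tendsto_at_iff_tendsto_nhds .
  from eventually_compose_filterlim[OF h'(1) this] inv_u
  show "\<forall>\<^sub>F x in nhds (\<phi> p). h (f (inv_into U \<phi> x)) \<in> W"
    by eventually_elim simp
  have "((\<rho> \<circ> h \<circ> inv_into V \<psi>) \<circ> u has_derivative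
      chart_deriv (V, \<psi>) (W, \<rho>) h (f p) \<circ> chart_deriv (U, \<phi>) (V, \<psi>) f p) (at (\<phi> p))"
    using f'(2) h'(2) by (intro diff_chain_at) (simp_all add: up flip: u_def)
  then show "(\<rho> \<circ> (h \<circ> f) \<circ> inv_into U \<phi> has_derivative
      chart_deriv (V, \<psi>) (W, \<rho>) h (f p) \<circ> chart_deriv (U, \<phi>) (V, \<psi>) f p) (at (\<phi> p))"
    by (rule has_derivative_eventually_cong) (use inv_u in \<open>eventually_elim, simp\<close>)
qed

lemma chart_differentiable_comp:
  assumes mfd: "smooth_manifold T A"
    and inj: "\<And>V \<psi>. (V, \<psi>) \<in> A' \<Longrightarrow> inj_on \<psi> V"
    and f: "chart_differentiable A A' f p" and h: "chart_differentiable A' A'' h (f p)"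
    and d: "(V, \<psi>) \<in> A'" "f p \<in> V"
  shows "chart_differentiable A A'' (h \<circ> f) p"
  unfolding chart_differentiable_def
proof (intro allI impI, elim conjE)
  fix U \<phi> W \<rho>
  assume *: "(U, \<phi>) \<in> A" "(W, \<rho>) \<in> A''" "p \<in> U" "(h \<circ> f) p \<in> W"
  then have "h (f p) \<in> W" by simp
  note chain = chart_chain[OF mfd inj f h *(1,3) d *(2) this]
  show "(\<forall>\<^sub>F x in nhds (\<phi> p). (h \<circ> f) (inv_into U \<phi> x) \<in> W) \<and>
      \<rho> \<circ> (h \<circ> f) \<circ> inv_into U \<phi> differentiable at (\<phi> p)"
    using chain(1) differentiableI[OF chain(2)] by (simp only: o_apply)
qed

lemma chart_deriv_comp:
  assumes mfd: "smooth_manifold T A"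
    and inj: "\<And>V \<psi>. (V, \<psi>) \<in> A' \<Longrightarrow> inj_on \<psi> V"
    and f: "chart_differentiable A A' f p" and h: "chart_differentiable A' A'' h (f p)"
    and c: "(U, \<phi>) \<in> A" "p \<in> U" and d: "(V, \<psi>) \<in> A'" "f p \<in> V"
    and e: "(W, \<rho>) \<in> A''" "h (f p) \<in> W"
  shows "chart_deriv (U, \<phi>) (W, \<rho>) (h \<circ> f) p =
      chart_deriv (V, \<psi>) (W, \<rho>) h (f p) \<circ> chart_deriv (U, \<phi>) (V, \<psi>) f p"
  using frechet_derivative_at[OF chart_chain(2)[OF mfd inj f h c d e]]
  by (simp add: chart_deriv_def)

lemma chart_deriv_cong:
  assumes mfd: "smooth_manifold T A" and f: "chart_differentiable A A' f p"
    and c: "(U, \<phi>) \<in> A" "p \<in> U" and d: "(V, \<psi>) \<in> A'" "f p \<in> V"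
    and eq: "\<And>x. x \<in> U \<Longrightarrow> f x = h x"
  shows "chart_deriv (U, \<phi>) (V, \<psi>) f p = chart_deriv (U, \<phi>) (V, \<psi>) h p"
proof -
  have "\<forall>\<^sub>F x in nhds (\<phi> p). (\<psi> \<circ> f \<circ> inv_into U \<phi>) x = (\<psi> \<circ> h \<circ> inv_into U \<phi>) x"
    using eventually_chart[OF mfd c c(2) chart_openin[OF mfd c(1)]]
    by eventually_elim (simp add: eq)
  note frechet_derivative_at[OF
      has_derivative_eventually_cong[OF chart_differentiableD(2)[OF f c(1) d(1) c(2) d(2)] this]]
  then show ?thesis unfolding chart_deriv_def[of _ _ h] fst_conv snd_conv .
qed

section \<open>The adjoint representation\<close>

lemma inv_into_map_prod:
  assumes "inj_on \<phi> U" "inj_on \<psi> V" "x \<in> \<phi> ` U" "y \<in> \<psi> ` V"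
  shows "inv_into (U \<times> V) (map_prod \<phi> \<psi>) (x, y) = (inv_into U \<phi> x, inv_into V \<psi> y)"
proof (rule inv_into_f_eq)
  show "inj_on (map_prod \<phi> \<psi>) (U \<times> V)" using assms(1,2) by (rule map_prod_inj_on)
qed (use assms in \<open>auto intro: inv_into_into simp: f_inv_into_f\<close>)

definition conjugation :: "('g, 'b) monoid_scheme \<Rightarrow> 'g \<Rightarrow> 'g \<Rightarrow> 'g" where
  "conjugation G a x = a \<otimes>\<^bsub>G\<^esub> x \<otimes>\<^bsub>G\<^esub> inv\<^bsub>G\<^esub> a"

context
  fixes G :: "('g, 'm::euclidean_space) smooth_group"
  assumes G: "lie_group G"
begin

interpretation group G using G by (simp add: lie_group_def)

lemma lie_group_manifold: "smooth_manifold (topol G) (atlas G)"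
  using G by (simp add: lie_group_def)

lemma lie_group_topspace: "topspace (topol G) = carrier G"
  using G by (simp add: lie_group_def)

lemmas lie_group_chart_inj = chart_inj[OF lie_group_manifold]

lemma lie_group_chart_subset: "(U, \<phi>) \<in> atlas G \<Longrightarrow> p \<in> U \<Longrightarrow> p \<in> carrier G"
  using chart_subset[OF lie_group_manifold] lie_group_topspace by blast

lemma lie_group_chart_at: "p \<in> carrier G \<Longrightarrow> \<exists>U \<phi>. (U, \<phi>) \<in> atlas G \<and> p \<in> U"
  using chart_cover[OF lie_group_manifold] lie_group_topspace by blast

lemma inj_prod_chart: "(Z, \<psi>) \<in> prod_atlas (atlas G) (atlas G) \<Longrightarrow> inj_on \<psi> Z"
  by (auto simp: prod_atlas_def intro!: map_prod_inj_on lie_group_chart_inj)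

lemma prod_chart_at:
  assumes "p \<in> carrier G" "q \<in> carrier G"
  shows "\<exists>Z \<psi>. (Z, \<psi>) \<in> prod_atlas (atlas G) (atlas G) \<and> (p, q) \<in> Z"
proof -
  obtain U \<phi> where U: "(U, \<phi>) \<in> atlas G" "p \<in> U" using lie_group_chart_at[OF assms(1)] by blast
  obtain V \<psi> where V: "(V, \<psi>) \<in> atlas G" "q \<in> V" using lie_group_chart_at[OF assms(2)] by blast
  have "(U \<times> V, map_prod \<phi> \<psi>) \<in> prod_atlas (atlas G) (atlas G)"
    using U(1) V(1) by (auto simp: prod_atlas_def)
  then show ?thesis using U(2) V(2) by blast
qed

text \<open>
  Full smoothness is recorded and not one derivative only, because differentiating \<open>Ad\<close> takes two
  derivatives of the multiplication.
\<close>

lemma smooth_mult: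
  assumes c: "(U, \<phi>) \<in> atlas G" "(V, \<psi>) \<in> atlas G" "(W, \<rho>) \<in> atlas G"
  shows "smooth_on (map_prod \<phi> \<psi> ` {z \<in> U \<times> V. fst z \<otimes>\<^bsub>G\<^esub> snd z \<in> W})
      (\<rho> \<circ> (\<lambda>(x, y). x \<otimes>\<^bsub>G\<^esub> y) \<circ> inv_into (U \<times> V) (map_prod \<phi> \<psi>))"
proof -
  have "\<forall>(U, \<phi>)\<in>prod_atlas (atlas G) (atlas G). \<forall>(V, \<psi>)\<in>atlas G.
      smooth_on (\<phi> ` {p \<in> U. (\<lambda>(x, y). x \<otimes>\<^bsub>G\<^esub> y) p \<in> V}) (\<psi> \<circ> (\<lambda>(x, y). x \<otimes>\<^bsub>G\<^esub> y) \<circ> inv_into U \<phi>)"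
    using G unfolding lie_group_def smooth_map_def by simp
  moreover have "(U \<times> V, map_prod \<phi> \<psi>) \<in> prod_atlas (atlas G) (atlas G)"
    using c by (auto simp: prod_atlas_def)
  ultimately have "\<forall>(W, \<rho>)\<in>atlas G. smooth_on (map_prod \<phi> \<psi> ` {p \<in> U \<times> V. (\<lambda>(x, y). x \<otimes>\<^bsub>G\<^esub> y) p \<in> W})
      (\<rho> \<circ> (\<lambda>(x, y). x \<otimes>\<^bsub>G\<^esub> y) \<circ> inv_into (U \<times> V) (map_prod \<phi> \<psi>))"
    by (auto dest: bspec)
  from bspec[OF this c(3)] show ?thesis by (simp add: case_prod_unfold)
qed

lemma mult_chart_differentiable:
  "chart_differentiable (prod_atlas (atlas G) (atlas G)) (atlas G) (\<lambda>(x, y). x \<otimes>\<^bsub>G\<^esub> y) (p, q)"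
  unfolding chart_differentiable_def
proof (intro allI impI, elim conjE, intro conjI)
  fix Z \<zeta> W \<rho>
  assume Z: "(Z, \<zeta>) \<in> prod_atlas (atlas G) (atlas G)" and W: "(W, \<rho>) \<in> atlas G"
    and pq: "(p, q) \<in> Z" "(case (p, q) of (x, y) \<Rightarrow> x \<otimes>\<^bsub>G\<^esub> y) \<in> W"
  obtain U \<phi> V \<psi> where c: "Z = U \<times> V" "\<zeta> = map_prod \<phi> \<psi>" "(U, \<phi>) \<in> atlas G" "(V, \<psi>) \<in> atlas G"
    using Z by (auto simp: prod_atlas_def)
  have p: "p \<in> U" "q \<in> V" "p \<otimes>\<^bsub>G\<^esub> q \<in> W" using pq c by auto
  define S where "S = {z \<in> topspace (prod_topology (topol G) (topol G)). (\<lambda>(x, y). x \<otimes>\<^bsub>G\<^esub> y) z \<in> W}"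
  have "openin (prod_topology (topol G) (topol G)) S"
    unfolding S_def using G chart_openin[OF lie_group_manifold W]
    by (intro openin_continuous_map_preimage[where Y = "topol G"])
      (simp_all add: lie_group_def smooth_map_def)
  moreover have "(p, q) \<in> S"
    using p c lie_group_chart_subset by (simp add: S_def lie_group_topspace)
  ultimately obtain P R where PR: "openin (topol G) P" "openin (topol G) R" "p \<in> P" "q \<in> R" "P \<times> R \<subseteq> S"
    unfolding openin_prod_topology_alt by meson
  have "\<forall>\<^sub>F z in nhds (\<phi> p) \<times>\<^sub>F nhds (\<psi> q).
      (fst z \<in> \<phi> ` U \<and> inv_into U \<phi> (fst z) \<in> U \<and> inv_into U \<phi> (fst z) \<in> P) \<and>
      (snd z \<in> \<psi> ` V \<and> inv_into V \<psi> (snd z) \<in> V \<and> inv_into V \<psi> (snd z) \<in> R)"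
    unfolding eventually_prod_filter
    using eventually_chart[OF lie_group_manifold c(3) p(1) PR(3,1)] eventually_chart[OF lie_group_manifold c(4) p(2) PR(4,2)]
    by fastforce
  then have "\<forall>\<^sub>F z in nhds (\<zeta> (p, q)).
      (fst z \<in> \<phi> ` U \<and> inv_into U \<phi> (fst z) \<in> U \<and> inv_into U \<phi> (fst z) \<in> P) \<and>
      (snd z \<in> \<psi> ` V \<and> inv_into V \<psi> (snd z) \<in> V \<and> inv_into V \<psi> (snd z) \<in> R)"
    by (simp add: nhds_prod c(2))
  then show "\<forall>\<^sub>F z in nhds (\<zeta> (p, q)). (case inv_into Z \<zeta> z of (x, y) \<Rightarrow> x \<otimes>\<^bsub>G\<^esub> y) \<in> W"
  proof eventually_elim
    case (elim z)
    then have "inv_into Z \<zeta> z = (inv_into U \<phi> (fst z), inv_into V \<psi> (snd z))"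
      using inv_into_map_prod[OF lie_group_chart_inj[OF c(3)] lie_group_chart_inj[OF c(4)], of "fst z" "snd z"]
      by (simp add: c)
    moreover have "(inv_into U \<phi> (fst z), inv_into V \<psi> (snd z)) \<in> S" using elim PR(5) by blast
    ultimately show ?case by (simp add: S_def)
  qed
  have "\<zeta> (p, q) \<in> map_prod \<phi> \<psi> ` {z \<in> U \<times> V. fst z \<otimes>\<^bsub>G\<^esub> snd z \<in> W}"
    unfolding c(2) using p by (intro imageI) simp
  then show "(\<rho> \<circ> (\<lambda>(x, y). x \<otimes>\<^bsub>G\<^esub> y) \<circ> inv_into Z \<zeta>) differentiable (at (\<zeta> (p, q)))"
    unfolding c(1,2) by (rule smooth_on_differentiable(1)[OF smooth_mult[OF c(3,4) W]])
qed

lemma chart_differentiable_mult: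
  assumes f: "chart_differentiable (atlas G) (atlas G) f p" "f p \<in> carrier G"
    and h: "chart_differentiable (atlas G) (atlas G) h p" "h p \<in> carrier G"
  shows "chart_differentiable (atlas G) (atlas G) (\<lambda>x. f x \<otimes>\<^bsub>G\<^esub> h x) p"
proof -
  obtain Z \<psi> where "(Z, \<psi>) \<in> prod_atlas (atlas G) (atlas G)" "(f p, h p) \<in> Z"
    using prod_chart_at[OF f(2) h(2)] by blast
  from chart_differentiable_comp[OF lie_group_manifold inj_prod_chart
      chart_differentiable_Pair[OF f(1) h(1)] mult_chart_differentiable this]
  show ?thesis by (simp add: comp_def)
qed

lemma chart_differentiable_inv: "chart_differentiable (atlas G) (atlas G) (\<lambda>x. inv\<^bsub>G\<^esub> x) p"
  using G by (intro smooth_map_chart_differentiable[OF lie_group_manifold lie_group_manifold]) (simp add: lie_group_def)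

lemma chart_differentiable_conjugation:
  assumes "a \<in> carrier G" "p \<in> carrier G"
  shows "chart_differentiable (atlas G) (atlas G) (conjugation G a) p"
  unfolding conjugation_def[abs_def]
  using assms by (intro chart_differentiable_mult chart_differentiable_const
      chart_differentiable_id[OF lie_group_manifold]) auto

lemma conjugation_one: "a \<in> carrier G \<Longrightarrow> conjugation G a \<one>\<^bsub>G\<^esub> = \<one>\<^bsub>G\<^esub>"
  and conjugation_closed: "a \<in> carrier G \<Longrightarrow> x \<in> carrier G \<Longrightarrow> conjugation G a x \<in> carrier G"
  and conjugation_by_one: "x \<in> carrier G \<Longrightarrow> conjugation G \<one>\<^bsub>G\<^esub> x = x"
  by (simp_all add: conjugation_def)

lemma conjugation_mult:
  "a \<in> carrier G \<Longrightarrow> b \<in> carrier G \<Longrightarrow> x \<in> carrier G \<Longrightarrow>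
    conjugation G (a \<otimes>\<^bsub>G\<^esub> b) x = conjugation G a (conjugation G b x)"
  by (simp add: conjugation_def inv_mult_group m_assoc)

context
  fixes U :: "'g set" and \<kappa> :: "'g \<Rightarrow> 'm"
  assumes c: "(U, \<kappa>) \<in> atlas G" and one: "\<one>\<^bsub>G\<^esub> \<in> U"
begin

lemma Ad_in_chart_eq: "Ad_in_chart G U \<kappa> a = chart_deriv (U, \<kappa>) (U, \<kappa>) (conjugation G a) \<one>\<^bsub>G\<^esub>"
  by (simp add: Ad_in_chart_def chart_deriv_def conjugation_def comp_def)

lemma has_derivative_Ad_in_chart:
  assumes "a \<in> carrier G"
  shows "(\<kappa> \<circ> conjugation G a \<circ> inv_into U \<kappa> has_derivative Ad_in_chart G U \<kappa> a) (at (\<kappa> \<one>\<^bsub>G\<^esub>))"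
  unfolding Ad_in_chart_eq
  using chart_differentiableD(2)[OF chart_differentiable_conjugation[OF assms one_closed] c c one]
  by (simp add: conjugation_one assms one)

lemma linear_Ad_in_chart: "a \<in> carrier G \<Longrightarrow> linear (Ad_in_chart G U \<kappa> a)"
  using has_derivative_linear[OF has_derivative_Ad_in_chart] .

text \<open>
  Conjugation by a product is the composition of the conjugations, and \<open>Ad\<close> is its derivative.
\<close>

lemma Ad_in_chart_mult:
  assumes "a \<in> carrier G" "b \<in> carrier G"
  shows "Ad_in_chart G U \<kappa> (a \<otimes>\<^bsub>G\<^esub> b) Z = Ad_in_chart G U \<kappa> a (Ad_in_chart G U \<kappa> b Z)"
proof -
  have one': "conjugation G b \<one>\<^bsub>G\<^esub> \<in> U" "conjugation G a (conjugation G b \<one>\<^bsub>G\<^esub>) \<in> U"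
    "conjugation G (a \<otimes>\<^bsub>G\<^esub> b) \<one>\<^bsub>G\<^esub> \<in> U"
    using assms one by (simp_all add: conjugation_one)
  have diff: "chart_differentiable (atlas G) (atlas G) (conjugation G x) \<one>\<^bsub>G\<^esub>" if "x \<in> carrier G" for x
    using chart_differentiable_conjugation[OF that one_closed] .
  have "chart_deriv (U, \<kappa>) (U, \<kappa>) (conjugation G (a \<otimes>\<^bsub>G\<^esub> b)) \<one>\<^bsub>G\<^esub> =
      chart_deriv (U, \<kappa>) (U, \<kappa>) (conjugation G a \<circ> conjugation G b) \<one>\<^bsub>G\<^esub>"
    by (rule chart_deriv_cong[OF lie_group_manifold diff c one c one'(3)])
      (use assms lie_group_chart_subset[OF c] in \<open>simp_all add: conjugation_mult\<close>)
  also have "\<dots> = chart_deriv (U, \<kappa>) (U, \<kappa>) (conjugation G a) \<one>\<^bsub>G\<^esub> \<circ>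
      chart_deriv (U, \<kappa>) (U, \<kappa>) (conjugation G b) \<one>\<^bsub>G\<^esub>"
  proof -
    have diff_a: "chart_differentiable (atlas G) (atlas G) (conjugation G a) (conjugation G b \<one>\<^bsub>G\<^esub>)"
      using diff[OF assms(1)] by (simp add: conjugation_one assms)
    show ?thesis
      using chart_deriv_comp[OF lie_group_manifold lie_group_chart_inj diff[OF assms(2)] diff_a c one c one'(1) c one'(2)]
      by (simp only: conjugation_one[OF assms(2)])
  qed
  finally show ?thesis by (simp add: Ad_in_chart_eq)
qed

lemma Ad_in_chart_one: "Ad_in_chart G U \<kappa> \<one>\<^bsub>G\<^esub> Z = Z"
proof -
  have "(\<kappa> \<circ> conjugation G \<one>\<^bsub>G\<^esub> \<circ> inv_into U \<kappa> has_derivative (\<lambda>x. x)) (at (\<kappa> \<one>\<^bsub>G\<^esub>))"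
  proof (rule has_derivative_eventually_cong[OF has_derivative_ident])
    show "\<forall>\<^sub>F x in nhds (\<kappa> \<one>\<^bsub>G\<^esub>). x = (\<kappa> \<circ> conjugation G \<one>\<^bsub>G\<^esub> \<circ> inv_into U \<kappa>) x"
      using eventually_chart[OF lie_group_manifold c one one chart_openin[OF lie_group_manifold c]]
      by eventually_elim (simp add: conjugation_by_one lie_group_chart_subset[OF c] f_inv_into_f)
  qed
  from has_derivative_unique[OF this has_derivative_Ad_in_chart] show ?thesis
    by (simp add: fun_eq_iff)
qed

text \<open>
  In a chart, conjugation by \<open>p\<close> is \<open>y \<mapsto> m (m (x, y), i x)\<close> with \<open>m\<close> the multiplication, \<open>i\<close> the
  inversion and \<open>x = \<kappa> p\<close>. Its derivative in \<open>y\<close> at the identity \<open>e\<close> is a directional derivative of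
  \<open>m\<close> at \<open>(x, i x)\<close>, in a direction that is itself a directional derivative of \<open>m\<close> at \<open>(x, e)\<close>. Directional
  derivatives of \<open>m\<close> in fixed directions are differentiable in the base point; the varying direction
  is handled by expanding it in a basis.
\<close>

lemma Ad_in_chart_differentiable:
  "(\<lambda>x. Ad_in_chart G U \<kappa> (inv_into U \<kappa> x) Z) differentiable (at (\<kappa> \<one>\<^bsub>G\<^esub>))"
proof -
  define e where "e = \<kappa> \<one>\<^bsub>G\<^esub>"
  define m where "m = \<kappa> \<circ> (\<lambda>(x, y). x \<otimes>\<^bsub>G\<^esub> y) \<circ> inv_into (U \<times> U) (map_prod \<kappa> \<kappa>)"
  define S where "S = map_prod \<kappa> \<kappa> ` {z \<in> U \<times> U. fst z \<otimes>\<^bsub>G\<^esub> snd z \<in> U}"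
  define i where "i = \<kappa> \<circ> (\<lambda>x. inv\<^bsub>G\<^esub> x) \<circ> inv_into U \<kappa>"
  define Dm where "Dm = (\<lambda>v z. frechet_derivative m (at z) v)"
  have smooth: "smooth_on S m"
    unfolding S_def m_def by (rule smooth_mult[OF c c c])
  have m_diff: "m differentiable (at z)" and Dm_diff: "Dm v differentiable (at z)" if "z \<in> S" for z v
    using smooth_on_differentiable[OF smooth that] by (simp_all add: Dm_def)
  have m_deriv: "(m has_derivative (\<lambda>v. Dm v z)) (at z)" if "z \<in> S" for z
    using m_diff[OF that] by (simp add: Dm_def frechet_derivative_works)
  have m_eq: "m (\<kappa> p, \<kappa> q) = \<kappa> (p \<otimes>\<^bsub>G\<^esub> q)" if "p \<in> U" "q \<in> U" for p q
    using that inv_into_map_prod[OF lie_group_chart_inj[OF c] lie_group_chart_inj[OF c], of "\<kappa> p" "\<kappa> q"]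
    by (simp add: m_def chart_inv_into[OF lie_group_manifold c])
  have in_S: "(\<kappa> p, \<kappa> q) \<in> S" if "p \<in> U" "q \<in> U" "p \<otimes>\<^bsub>G\<^esub> q \<in> U" for p q
    unfolding S_def using that by (intro image_eqI[of _ _ "(p, q)"]) auto
  have Ad_eq: "Ad_in_chart G U \<kappa> p Z = Dm (Dm (0, Z) (\<kappa> p, e), 0) (\<kappa> p, i (\<kappa> p))"
    if p: "p \<in> U" "inv\<^bsub>G\<^esub> p \<in> U" for p
  proof -
    have pG: "p \<in> carrier G" using lie_group_chart_subset[OF c p(1)] .
    have ip: "i (\<kappa> p) = \<kappa> (inv\<^bsub>G\<^esub> p)" by (simp add: i_def chart_inv_into[OF lie_group_manifold c p(1)])
    have me: "m (\<kappa> p, e) = \<kappa> p" using m_eq[OF p(1) one] pG by (simp add: e_def)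
    have S1: "(\<kappa> p, e) \<in> S" and S2: "(m (\<kappa> p, e), i (\<kappa> p)) \<in> S"
      unfolding me unfolding e_def ip using in_S p one pG by simp_all
    have "((\<lambda>y. m (\<kappa> p, y)) has_derivative (\<lambda>h. Dm (0, h) (\<kappa> p, e))) (at e)"
      using diff_chain_at[OF has_derivative_Pair[OF has_derivative_const has_derivative_ident] m_deriv[OF S1]]
      by (simp add: comp_def)
    from has_derivative_Pair[OF this has_derivative_const[of "i (\<kappa> p)"]] m_deriv[OF S2]
    have "((\<lambda>y. m (m (\<kappa> p, y), i (\<kappa> p))) has_derivative
        (\<lambda>h. Dm (Dm (0, h) (\<kappa> p, e), 0) (\<kappa> p, i (\<kappa> p)))) (at e)"
      using diff_chain_at[of "\<lambda>y. (m (\<kappa> p, y), i (\<kappa> p))" _ e m] by (simp add: comp_def me)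
    moreover have "\<forall>\<^sub>F y in nhds e. m (m (\<kappa> p, y), i (\<kappa> p)) =
        (\<kappa> \<circ> conjugation G p \<circ> inv_into U \<kappa>) y"
    proof -
      have "chart_differentiable (atlas G) (atlas G) (\<lambda>y. p \<otimes>\<^bsub>G\<^esub> y) \<one>\<^bsub>G\<^esub>"
        using pG by (intro chart_differentiable_mult chart_differentiable_const
            chart_differentiable_id[OF lie_group_manifold]) auto
      then have "\<forall>\<^sub>F y in nhds e. p \<otimes>\<^bsub>G\<^esub> inv_into U \<kappa> y \<in> U"
        unfolding e_def using pG p(1) by (intro chart_differentiableD(1)[OF _ c c one]) auto
      moreover have "\<forall>\<^sub>F y in nhds e. y \<in> \<kappa> ` U \<and> inv_into U \<kappa> y \<in> U \<and> inv_into U \<kappa> y \<in> U"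
        unfolding e_def by (rule eventually_chart[OF lie_group_manifold c one one chart_openin[OF lie_group_manifold c]])
      ultimately show ?thesis
      proof eventually_elim
        case (elim y)
        define q where "q = inv_into U \<kappa> y"
        have q: "q \<in> U" "p \<otimes>\<^bsub>G\<^esub> q \<in> U" "y = \<kappa> q"
          using elim by (simp_all add: q_def f_inv_into_f)
        show ?case
          using m_eq[OF p(1) q(1)] m_eq[OF q(2) p(2)]
          by (simp add: q(3) ip conjugation_def chart_inv_into[OF lie_group_manifold c q(1)])
      qed
    qed
    ultimately have "(\<kappa> \<circ> conjugation G p \<circ> inv_into U \<kappa> has_derivative
        (\<lambda>h. Dm (Dm (0, h) (\<kappa> p, e), 0) (\<kappa> p, i (\<kappa> p)))) (at e)"
      by (rule has_derivative_eventually_cong)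
    from has_derivative_unique[OF this has_derivative_Ad_in_chart[OF pG, folded e_def]]
    show ?thesis by metis
  qed
  have i_diff: "i differentiable (at e)" and i_ev: "\<forall>\<^sub>F x in nhds e. inv\<^bsub>G\<^esub> (inv_into U \<kappa> x) \<in> U"
    using chart_differentiableD[OF chart_differentiable_inv c c one] one
    by (auto simp: i_def e_def intro: differentiableI)
  have ie: "i e = e" by (simp add: i_def e_def chart_inv_into[OF lie_group_manifold c one])
  have ee: "(e, e) \<in> S" unfolding e_def using in_S one by simp
  define w where "w = (\<lambda>x. Dm (0, Z) (x, e))"
  have pair1: "(\<lambda>x. (x, e)) differentiable (at e)"
    by (auto simp: differentiable_def intro!: derivative_eq_intros)
  have pair2: "(\<lambda>x. (x, i x)) differentiable (at e)"
    using i_diff has_derivative_Pair[OF has_derivative_ident] unfolding differentiable_def by blast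
  have "w differentiable (at e)"
    unfolding w_def using differentiable_chain_at[OF pair1, of "Dm (0, Z)"] Dm_diff[OF ee]
    by (simp add: comp_def)
  moreover have "(\<lambda>x. Dm (b, 0) (x, i x)) differentiable (at e)" for b
    using differentiable_chain_at[OF pair2, of "Dm (b, 0)"] Dm_diff[OF ee] ie
    by (simp add: comp_def)
  ultimately have sum: "(\<lambda>x. \<Sum>b\<in>Basis. (w x \<bullet> b) *\<^sub>R Dm (b, 0) (x, i x)) differentiable (at e)"
    by (intro differentiable_sum ballI differentiable_scaleR differentiable_inner differentiable_const) auto
  have ev: "\<forall>\<^sub>F x in nhds e. (\<Sum>b\<in>Basis. (w x \<bullet> b) *\<^sub>R Dm (b, 0) (x, i x)) =
      Ad_in_chart G U \<kappa> (inv_into U \<kappa> x) Z"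
    using i_ev eventually_chart[OF lie_group_manifold c one one chart_openin[OF lie_group_manifold c], folded e_def]
  proof eventually_elim
    case (elim x)
    define p where "p = inv_into U \<kappa> x"
    have p: "p \<in> U" "inv\<^bsub>G\<^esub> p \<in> U" "\<kappa> p = x" using elim by (simp_all add: p_def f_inv_into_f)
    have "(x, i x) \<in> S"
      using in_S[OF p(1,2)] one lie_group_chart_subset[OF c p(1)]
      by (simp add: i_def p_def[symmetric] p(3))
    then have lin: "linear (\<lambda>v. Dm v (x, i x))" by (rule has_derivative_linear[OF m_deriv])
    have "(w x, 0 :: 'm) = (\<Sum>b\<in>Basis. (w x \<bullet> b) *\<^sub>R (b, 0))"
      by (simp add: prod_eq_iff fst_sum snd_sum euclidean_representation)
    then have "Dm (w x, 0) (x, i x) = (\<Sum>b\<in>Basis. (w x \<bullet> b) *\<^sub>R Dm (b, 0) (x, i x))"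
      by (simp only: linear_sum[OF lin] linear_scale[OF lin])
    then show ?case using Ad_eq[OF p(1,2)] by (simp add: w_def p(3) flip: p_def)
  qed
  obtain D where "((\<lambda>x. \<Sum>b\<in>Basis. (w x \<bullet> b) *\<^sub>R Dm (b, 0) (x, i x)) has_derivative D) (at e)"
    using sum unfolding differentiable_def ..
  from has_derivative_eventually_cong[OF this ev] show ?thesis
    unfolding e_def by (rule differentiableI)
qed

text \<open>
  Differentiate \<open>Ad (a p a\<inverse>) (Ad a Y) = Ad a (Ad p Y)\<close> with respect to \<open>p\<close> at the identity.
\<close>

lemma bracket_Ad_in_chart:
  assumes a: "a \<in> carrier G"
  shows "bracket_in_chart G U \<kappa> (Ad_in_chart G U \<kappa> a X) (Ad_in_chart G U \<kappa> a Y) =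
    Ad_in_chart G U \<kappa> a (bracket_in_chart G U \<kappa> X Y)"
proof -
  define e where "e = \<kappa> \<one>\<^bsub>G\<^esub>"
  define T where "T = Ad_in_chart G U \<kappa>"
  define F where "F = (\<lambda>Z x. T (inv_into U \<kappa> x) Z)"
  define u where "u = \<kappa> \<circ> conjugation G a \<circ> inv_into U \<kappa>"
  have F: "(F Z has_derivative (\<lambda>X. bracket_in_chart G U \<kappa> X Z)) (at e)" for Z
    using Ad_in_chart_differentiable[of Z]
    by (simp add: bracket_in_chart_def F_def T_def e_def frechet_derivative_works)
  have u: "(u has_derivative T a) (at e)" and ue: "u e = e"
    using has_derivative_Ad_in_chart[OF a]
    by (simp_all add: u_def T_def e_def chart_inv_into[OF lie_group_manifold c one] conjugation_one a)
  have "\<forall>\<^sub>F x in nhds e. conjugation G a (inv_into U \<kappa> x) \<in> U"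
    unfolding e_def
    using chart_differentiableD(1)[OF chart_differentiable_conjugation[OF a one_closed] c c one]
    by (simp add: conjugation_one a one)
  with eventually_chart[OF lie_group_manifold c one one chart_openin[OF lie_group_manifold c], folded e_def]
  have eq: "\<forall>\<^sub>F x in nhds e. (T a \<circ> F Y) x = (F (T a Y) \<circ> u) x"
  proof eventually_elim
    case (elim x)
    define p where "p = inv_into U \<kappa> x"
    have p: "p \<in> carrier G" using lie_group_chart_subset[OF c] elim by (simp add: p_def)
    have "conjugation G a p \<otimes>\<^bsub>G\<^esub> a = a \<otimes>\<^bsub>G\<^esub> p"
      using a p by (simp add: conjugation_def m_assoc)
    then have "T (conjugation G a p) (T a Y) = T a (T p Y)"
      using a p by (simp add: T_def conjugation_closed flip: Ad_in_chart_mult)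
    moreover have "inv_into U \<kappa> (u x) = conjugation G a p"
      using elim by (simp add: u_def p_def chart_inv_into[OF lie_group_manifold c])
    ultimately show ?case by (simp add: F_def p_def)
  qed
  have Ta: "bounded_linear (T a)"
    unfolding T_def by (rule linear_conv_bounded_linear[THEN iffD1, OF linear_Ad_in_chart[OF a]])
  have "(T a \<circ> F Y has_derivative T a \<circ> (\<lambda>X. bracket_in_chart G U \<kappa> X Y)) (at e)"
    by (intro diff_chain_at F bounded_linear_imp_has_derivative Ta)
  from has_derivative_eventually_cong[OF this eq]
  have 1: "(F (T a Y) \<circ> u has_derivative T a \<circ> (\<lambda>X. bracket_in_chart G U \<kappa> X Y)) (at e)" .
  have 2: "(F (T a Y) \<circ> u has_derivative (\<lambda>X. bracket_in_chart G U \<kappa> X (T a Y)) \<circ> T a) (at e)"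
    by (intro diff_chain_at u) (simp add: ue F)
  from has_derivative_unique[OF 1 2] show ?thesis
    unfolding T_def by (simp add: comp_def) metis
qed

end

end

text \<open>
  For \<open>a \<in> Q\<close> the inclusion of \<open>Q\<close> intertwines the conjugations by \<open>a\<close> in \<open>Q\<close> and in \<open>G\<close>. Differentiating
  at the identity, \<open>Ad a\<close> maps the image of the tangent space of \<open>Q\<close> to itself.
\<close>

lemma Ad_in_chart_subgroup:
  fixes Q :: "('g, 'q::euclidean_space) smooth_group" and G :: "('g, 'm::euclidean_space) smooth_group"
  assumes sub: "lie_subgroup Q G" and a: "a \<in> carrier Q"
    and c: "(U, \<kappa>) \<in> atlas G" "\<one>\<^bsub>G\<^esub> \<in> U"
    and d: "(V, \<psi>) \<in> atlas Q" "\<one>\<^bsub>Q\<^esub> \<in> V"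
    and Z: "Z \<in> range (frechet_derivative (\<kappa> \<circ> inv_into V \<psi>) (at (\<psi> \<one>\<^bsub>Q\<^esub>)))"
  shows "Ad_in_chart G U \<kappa> a Z \<in> range (frechet_derivative (\<kappa> \<circ> inv_into V \<psi>) (at (\<psi> \<one>\<^bsub>Q\<^esub>)))"
proof -
  have Q: "lie_group Q" and G: "lie_group G" and hom: "(\<lambda>x. x) \<in> hom Q G"
    and smooth: "smooth_map (topol Q) (atlas Q) (topol G) (atlas G) (\<lambda>x. x)"
    using sub by (auto simp: lie_subgroup_def)
  interpret Q: group Q using Q by (simp add: lie_group_def)
  interpret G: group G using G by (simp add: lie_group_def)
  interpret group_hom Q G "\<lambda>x. x" using hom by unfold_locales
  have one: "\<one>\<^bsub>Q\<^esub> = \<one>\<^bsub>G\<^esub>" by (rule hom_one)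
  have aG: "a \<in> carrier G" using a by (rule hom_closed)
  have conj: "conjugation Q a x = conjugation G a x" if "x \<in> carrier Q" for x
  proof -
    have 1: "a \<otimes>\<^bsub>Q\<^esub> x \<otimes>\<^bsub>Q\<^esub> inv\<^bsub>Q\<^esub> a = (a \<otimes>\<^bsub>Q\<^esub> x) \<otimes>\<^bsub>G\<^esub> inv\<^bsub>Q\<^esub> a"
      by (rule hom_mult[OF Q.m_closed[OF a that] Q.inv_closed[OF a]])
    have 2: "a \<otimes>\<^bsub>Q\<^esub> x = a \<otimes>\<^bsub>G\<^esub> x" using a that by (rule hom_mult)
    have 3: "inv\<^bsub>Q\<^esub> a = inv\<^bsub>G\<^esub> a" using a by (rule hom_inv)
    show ?thesis unfolding conjugation_def 1 unfolding 2 3 ..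
  qed
  define D where "D = chart_deriv (V, \<psi>) (U, \<kappa>) (\<lambda>x. x) \<one>\<^bsub>Q\<^esub>"
  have D: "D = frechet_derivative (\<kappa> \<circ> inv_into V \<psi>) (at (\<psi> \<one>\<^bsub>Q\<^esub>))"
    by (simp add: D_def chart_deriv_def comp_def)
  have incl: "chart_differentiable (atlas Q) (atlas G) (\<lambda>x. x) p" for p
    by (rule smooth_map_chart_differentiable[OF lie_group_manifold[OF Q] lie_group_manifold[OF G] smooth])
  note conjQ = chart_differentiable_conjugation[OF Q a Q.one_closed]
  note conjG = chart_differentiable_conjugation[OF G aG G.one_closed]
  have "Ad_in_chart G U \<kappa> a \<circ> D = chart_deriv (V, \<psi>) (U, \<kappa>) (conjugation G a \<circ> (\<lambda>x. x)) \<one>\<^bsub>Q\<^esub>"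
    unfolding D_def Ad_in_chart_eq[OF G c]
    unfolding one[symmetric]
    by (rule chart_deriv_comp[OF lie_group_manifold[OF Q] lie_group_chart_inj[OF G] incl, symmetric])
      (use conjG c d in \<open>simp_all add: one conjugation_one[OF G aG]\<close>)
  also have "\<dots> = chart_deriv (V, \<psi>) (U, \<kappa>) ((\<lambda>x. x) \<circ> conjugation Q a) \<one>\<^bsub>Q\<^esub>"
    by (rule chart_deriv_cong[OF lie_group_manifold[OF Q] chart_differentiable_comp[OF lie_group_manifold[OF Q] lie_group_chart_inj[OF G] incl _ c(1)] d c(1)])
      (use conjG c(2) conj lie_group_chart_subset[OF Q d(1)] in \<open>simp_all add: one conjugation_one[OF G aG]\<close>)
  also have "\<dots> = D \<circ> chart_deriv (V, \<psi>) (V, \<psi>) (conjugation Q a) \<one>\<^bsub>Q\<^esub>"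
  proof -
    have fixes_one: "conjugation Q a \<one>\<^bsub>Q\<^esub> = \<one>\<^bsub>Q\<^esub>" by (rule conjugation_one[OF Q a])
    then have mem: "conjugation Q a \<one>\<^bsub>Q\<^esub> \<in> V" "conjugation Q a \<one>\<^bsub>Q\<^esub> \<in> U"
      using d(2) c(2) one by simp_all
    have "chart_deriv (V, \<psi>) (U, \<kappa>) ((\<lambda>x. x) \<circ> conjugation Q a) \<one>\<^bsub>Q\<^esub> =
        chart_deriv (V, \<psi>) (U, \<kappa>) (\<lambda>x. x) (conjugation Q a \<one>\<^bsub>Q\<^esub>) \<circ>
        chart_deriv (V, \<psi>) (V, \<psi>) (conjugation Q a) \<one>\<^bsub>Q\<^esub>"
      by (rule chart_deriv_comp[OF lie_group_manifold[OF Q] lie_group_chart_inj[OF Q] conjQ incl d d(1) mem(1) c(1) mem(2)])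
    then show ?thesis unfolding fixes_one D_def .
  qed
  finally have "Ad_in_chart G U \<kappa> a (D v) \<in> range D" for v
    by (auto simp: fun_eq_iff)
  then show ?thesis using Z unfolding D by auto
qed

section \<open>Admissibility\<close>

context
  fixes br :: "'h::euclidean_space \<Rightarrow> 'h \<Rightarrow> 'h"
    and H :: "('g, 'm::euclidean_space) smooth_group"
    and U :: "'g set" and \<kappa> :: "'g \<Rightarrow> 'm" and \<iota> :: "'h \<Rightarrow> 'm"
  assumes H: "connected_lie_group_of br H U \<kappa> \<iota>"
begin

lemma lie_group_H: "lie_group H" and chart_H: "(U, \<kappa>) \<in> atlas H" "\<one>\<^bsub>H\<^esub> \<in> U"
  and linear_\<iota>: "linear \<iota>" and inj_\<iota>: "inj \<iota>"
  and bracket_\<iota>: "\<iota> (br X Y) = bracket_in_chart H U \<kappa> (\<iota> X) (\<iota> Y)"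
  using H by (auto simp: connected_lie_group_of_def bij_def)

lemma \<iota>_Ad: "\<iota> (Ad H U \<kappa> \<iota> a X) = Ad_in_chart H U \<kappa> a (\<iota> X)"
proof -
  have "surj \<iota>" using H by (auto simp: connected_lie_group_of_def bij_def)
  then show ?thesis by (simp add: Ad_def surj_f_inv_f)
qed

lemma Ad_automorphism:
  assumes a: "a \<in> carrier H"
  shows "linear (Ad H U \<kappa> \<iota> a)"
    and "Ad H U \<kappa> \<iota> a (br X Y) = br (Ad H U \<kappa> \<iota> a X) (Ad H U \<kappa> \<iota> a Y)"
proof -
  note lin = linear_Ad_in_chart[OF lie_group_H chart_H a]
  show "linear (Ad H U \<kappa> \<iota> a)"
    by (rule linearI; rule injD[OF inj_\<iota>])
      (simp_all add: \<iota>_Ad linear_add[OF lin] linear_add[OF linear_\<iota>]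
        linear_scale[OF lin] linear_scale[OF linear_\<iota>])
  show "Ad H U \<kappa> \<iota> a (br X Y) = br (Ad H U \<kappa> \<iota> a X) (Ad H U \<kappa> \<iota> a Y)"
    by (rule injD[OF inj_\<iota>])
      (simp only: \<iota>_Ad bracket_\<iota> bracket_Ad_in_chart[OF lie_group_H chart_H a])
qed

lemma Ad_inverse:
  assumes "a \<in> carrier H" "b \<in> carrier H" "a \<otimes>\<^bsub>H\<^esub> b = \<one>\<^bsub>H\<^esub>"
  shows "Ad H U \<kappa> \<iota> a (Ad H U \<kappa> \<iota> b X) = X"
proof (rule injD[OF inj_\<iota>])
  show "\<iota> (Ad H U \<kappa> \<iota> a (Ad H U \<kappa> \<iota> b X)) = \<iota> X"
    using Ad_in_chart_mult[OF lie_group_H chart_H assms(1,2), of "\<iota> X"]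
    by (simp add: \<iota>_Ad assms(3) Ad_in_chart_one[OF lie_group_H chart_H])
qed

lemma Ad_preserves_subalgebra:
  assumes Q: "connected_lie_subgroup_of Q H U \<kappa> \<iota> \<qq>" and a: "a \<in> carrier Q" and X: "X \<in> \<qq>"
  shows "Ad H U \<kappa> \<iota> a X \<in> \<qq>"
proof -
  have sub: "lie_subgroup Q H" using Q by (simp add: connected_lie_subgroup_of_def)
  then have gQ: "lie_group Q" by (simp add: lie_subgroup_def)
  then interpret Q: group Q by (simp add: lie_group_def)
  obtain V \<psi> where d: "(V, \<psi>) \<in> atlas Q" "\<one>\<^bsub>Q\<^esub> \<in> V"
    using lie_group_chart_at[OF gQ Q.one_closed] by blast
  have "\<forall>(V, \<psi>)\<in>atlas Q. \<one>\<^bsub>Q\<^esub> \<in> V \<longrightarrow>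
      range (frechet_derivative (\<kappa> \<circ> inv_into V \<psi>) (at (\<psi> \<one>\<^bsub>Q\<^esub>))) = \<iota> ` \<qq>"
    using Q by (simp add: connected_lie_subgroup_of_def)
  from bspec[OF this d(1)] d(2)
  have range: "range (frechet_derivative (\<kappa> \<circ> inv_into V \<psi>) (at (\<psi> \<one>\<^bsub>Q\<^esub>))) = \<iota> ` \<qq>" by simp
  have "Ad_in_chart H U \<kappa> a (\<iota> X) \<in> \<iota> ` \<qq>"
    using Ad_in_chart_subgroup[OF sub a chart_H d, of "\<iota> X"] X unfolding range by blast
  then show ?thesis
    unfolding \<iota>_Ad[symmetric] using inj_\<iota> by (simp add: inj_image_mem_iff)
qed

end

theorem corollary1:
  fixes br :: "'h::euclidean_space \<Rightarrow> 'h \<Rightarrow> 'h"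
    and hh :: "int \<Rightarrow> 'h set"
    and l :: nat
    and \<theta> :: "'h \<Rightarrow> 'h"
    and H :: "('g, 'm::euclidean_space) smooth_group"
    and U :: "'g set" and \<kappa> :: "'g \<Rightarrow> 'm" and \<iota> :: "'h \<Rightarrow> 'm"
    and Q :: "('g, 'q::euclidean_space) smooth_group"
  assumes "semisimple br"
    and "fundamental_gradation br l hh"
    and "connected_lie_group_of br H U \<kappa> \<iota>"
    and "connected_lie_subgroup_of Q H U \<kappa> \<iota> (nonneg_part hh)"
    and "cartan_involution br \<theta>"
    and "\<And>i. \<theta> ` hh i = hh (- i)"
  shows "admissible br hh H U \<kappa> \<iota> Q (killing_metric br \<theta>)"
  unfolding admissible_def
proof (intro conjI allI ballI)
  have br: "lie_algebra br" using assms(1) by (simp add: semisimple_def)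
  show "euclidean_metric (killing_metric br \<theta>)"
    by (rule killing_metric_euclidean[OF br assms(5)])
  show "adapted_metric hh (killing_metric br \<theta>)"
    by (rule killing_metric_adapted[OF br assms(2,5,6)])
  fix k \<phi> a
  assume \<phi>: "\<phi> \<in> cochains (neg_part hh) (Suc k)" and a: "a \<in> carrier Q"
  have sub: "lie_subgroup Q H" using assms(4) by (simp add: connected_lie_subgroup_of_def)
  then interpret group_hom Q H "\<lambda>x. x"
    by (auto simp: lie_subgroup_def lie_group_def group_hom_def group_hom_axioms_def)
  have aH: "a \<in> carrier H" using a by (rule hom_closed)
  have inv_Q: "inv\<^bsub>H\<^esub> a \<in> carrier Q" using a hom_inv[OF a] G.inv_closed[OF a] by simp
  have action: "cochain_action H U \<kappa> \<iota> hh a =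
      transport (neg_part hh) (Ad H U \<kappa> \<iota> a) (induced_on_neg hh (Ad H U \<kappa> \<iota> (inv\<^bsub>H\<^esub> a)))"
    by (simp add: fun_eq_iff cochain_action_def transport_def)
  show "codifferential br (killing_metric br \<theta>) (neg_part hh) k (cochain_action H U \<kappa> \<iota> hh a \<phi>) =
      cochain_action H U \<kappa> \<iota> hh a (codifferential br (killing_metric br \<theta>) (neg_part hh) k \<phi>)"
    unfolding action
  proof (rule codifferential_automorphism[OF br assms(2,5,6)])
    show "linear (Ad H U \<kappa> \<iota> a)" "linear (Ad H U \<kappa> \<iota> (inv\<^bsub>H\<^esub> a))"
      using Ad_automorphism(1)[OF assms(3)] aH by simp_all
    show "Ad H U \<kappa> \<iota> a (Ad H U \<kappa> \<iota> (inv\<^bsub>H\<^esub> a) x) = x"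
      "Ad H U \<kappa> \<iota> (inv\<^bsub>H\<^esub> a) (Ad H U \<kappa> \<iota> a x) = x" for x
      using aH by (simp_all add: Ad_inverse[OF assms(3)])
    show "Ad H U \<kappa> \<iota> a (br x y) = br (Ad H U \<kappa> \<iota> a x) (Ad H U \<kappa> \<iota> a y)" for x y
      by (rule Ad_automorphism(2)[OF assms(3) aH])
    show "Ad H U \<kappa> \<iota> (inv\<^bsub>H\<^esub> a) x \<in> nonneg_part hh" if "x \<in> nonneg_part hh" for x
      by (rule Ad_preserves_subalgebra[OF assms(3,4) inv_Q that])
  qed (rule \<phi>)
qed

end
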